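(* Let $\mathcal{A}$ be a weakly idempotent complete exact category, $(\mathcal{X},\mathcal{Y})$ a complete cotorsion pair in $\mathcal{A}$, and $\omega=\mathcal{X}\cap\mathcal{Y}$. Let $\mathrm{CoFib}_\omega$, $\mathrm{Fib}_\omega$, $\mathrm{Weq}_\omega$ be the classes of morphisms associated with $(\mathcal{X},\mathcal{Y})$ as defined in the context. If $(\mathrm{CoFib}_\omega,\mathrm{Fib}_\omega,\mathrm{Weq}_\omega)$ is a model structure on $\mathcal{A}$, then the cotorsion pair $(\mathcal{X},\mathcal{Y})$ is hereditary.
   Context: Exact categories are in the sense of Quillen, with conflations $X\xrightarrow{i}Y\xrightarrow{d}Z$, inflations $i$, deflations $d$; $0\to X\to Y\to Z\to 0$ is then called an admissible exact sequence. $\mathcal{A}$ is weakly idempotent complete if every splitting epimorphism is a deflation. $\operatorname{Ext}^1_{\mathcal{A}}$ is the Yoneda Ext of the exact structure. $\mathrm{CoFib}_\omega$ is the class of inflations $f$ with $\operatorname{Coker} f\in\mathcal{X}$. $\mathrm{Fib}_\omega$ is the class of morphisms $f:A\to B$ such that $\operatorname{Hom}_{\mathcal{A}}(W,f)$ is surjective for every $W\in\omega$. $\mathrm{Weq}_\omega$ is the class of morphisms $f:A\to B$ for which there exist $W\in\omega$ and $t:W\to B$ such that $(f,t):A\oplus W\to B$ is a deflation with $\operatorname{Ker}(f,t)\in\mathcal{Y}$. A cotorsion pair is a pair $(\mathcal{C},\mathcal{F})$ of classes of objects with $\mathcal{C}=\{X\mid\operatorname{Ext}^1_{\mathcal{A}}(X,F)=0\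 \forall F\in\mathcal{F}\}$ and $\mathcal{F}=\{Y\mid\operatorname{Ext}^1_{\mathcal{A}}(C,Y)=0\ \forall C\in\mathcal{C}\}$. It is complete if for every object $X$ there are admissible exact sequences $0\to F\to C\to X\to 0$ and $0\to X\to F'\to C'\to 0$ with $C,C'\in\mathcal{C}$, $F,F'\in\mathcal{F}$. It is hereditary if $\mathcal{C}$ is closed under kernels of deflations and $\mathcal{F}$ is closed under cokernels of inflations. A model structure on a category is a triple $(\mathrm{CoFib},\mathrm{Fib},\mathrm{Weq})$ of classes of morphisms satisfying: (two out of three) if two of $f,g,gf$ are in $\mathrm{Weq}$ so is the third; (retract) each of the three classes is closed under retracts; (lifting) morphisms in $\mathrm{CoFib}$ have the left lifting property with respect to $\mathrm{Fib}\cap\mathrm{Weq}$, and morphisms in $\mathrm{Fib}$ have the right lifting property with respect to $\mathrm{CoFib}\cap\mathrm{Weq}$; (factorization) every morphism $f$ factors as $f=pi$ with $i\in\mathrm{CoFib}\cap\mathrm{Weq}$, $p\in\mathrm{Fib}$, and as $f=qj$ with $j\in\mathrm{CoFib}$, $q\in\mathrm{Fib}\cap\mathrm{Weq}$. No limits or colimits are required. *)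

theory Defs
  imports "HOL-Algebra.Group"
begin

section \<open>Categories\<close>

record ('o, 'm) category =
  Obj :: "'o set"
  Arr :: "'m set"
  Dom :: "'m \<Rightarrow> 'o"
  Cod :: "'m \<Rightarrow> 'o"
  Ident :: "'o \<Rightarrow> 'm"
  Comp :: "'m \<Rightarrow> 'm \<Rightarrow> 'm" (infixr "\<cdot>\<index>" 70)

definition Hom :: "('o, 'm, 'z) category_scheme \<Rightarrow> 'o \<Rightarrow> 'o \<Rightarrow> 'm set" where
  "Hom C A B = {f \<in> Arr C. Dom C f = A \<and> Cod C f = B}"

text \<open>Composition is in applicative order: \<open>g \<cdot> f\<close> is \<open>f\<close> followed by \<open>g\<close>.\<close>

locale category =
  fixes C :: "('o, 'm, 'z) category_scheme" (structure)
  assumes Dom_in_Obj: "f \<in> Arr C \<Longrightarrow> Dom C f \<in> Obj C"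
    and Cod_in_Obj: "f \<in> Arr C \<Longrightarrow> Cod C f \<in> Obj C"
    and Ident_in_Hom: "A \<in> Obj C \<Longrightarrow> Ident C A \<in> Hom C A A"
    and Comp_in_Hom: "f \<in> Hom C A B \<Longrightarrow> g \<in> Hom C B D \<Longrightarrow> g \<cdot> f \<in> Hom C A D"
    and Comp_assoc: "f \<in> Hom C A B \<Longrightarrow> g \<in> Hom C B D \<Longrightarrow> h \<in> Hom C D E \<Longrightarrow>
      (h \<cdot> g) \<cdot> f = h \<cdot> (g \<cdot> f)"
    and Comp_Ident_left: "f \<in> Hom C A B \<Longrightarrow> Ident C B \<cdot> f = f"
    and Comp_Ident_right: "f \<in> Hom C A B \<Longrightarrow> f \<cdot> Ident C A = f"

definition is_iso :: "('o, 'm, 'z) category_scheme \<Rightarrow> 'm \<Rightarrow> bool" where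
  "is_iso C f \<longleftrightarrow> f \<in> Arr C \<and>
    (\<exists>g \<in> Hom C (Cod C f) (Dom C f).
      g \<cdot>\<^bsub>C\<^esub> f = Ident C (Dom C f) \<and> f \<cdot>\<^bsub>C\<^esub> g = Ident C (Cod C f))"

definition split_epi :: "('o, 'm, 'z) category_scheme \<Rightarrow> 'm \<Rightarrow> bool" where
  "split_epi C f \<longleftrightarrow> f \<in> Arr C \<and>
    (\<exists>s \<in> Hom C (Cod C f) (Dom C f). f \<cdot>\<^bsub>C\<^esub> s = Ident C (Cod C f))"

text \<open>The square \<open>f' \<cdot> i = i' \<cdot> f\<close> is a pushout of \<open>i\<close> and \<open>f\<close>;
  \<open>i'\<close> is the pushout of \<open>i\<close> along \<open>f\<close>.\<close>

definition is_pushout ::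
  "('o, 'm, 'z) category_scheme \<Rightarrow> 'm \<Rightarrow> 'm \<Rightarrow> 'm \<Rightarrow> 'm \<Rightarrow> bool" where
  "is_pushout C i f i' f' \<longleftrightarrow>
    i \<in> Arr C \<and> f \<in> Arr C \<and> i' \<in> Arr C \<and> f' \<in> Arr C \<and>
    Dom C i = Dom C f \<and> Dom C i' = Cod C f \<and> Dom C f' = Cod C i \<and> Cod C i' = Cod C f' \<and>
    f' \<cdot>\<^bsub>C\<^esub> i = i' \<cdot>\<^bsub>C\<^esub> f \<and>
    (\<forall>T \<in> Obj C. \<forall>u \<in> Hom C (Cod C i) T. \<forall>v \<in> Hom C (Cod C f) T.
      u \<cdot>\<^bsub>C\<^esub> i = v \<cdot>\<^bsub>C\<^esub> f \<longrightarrow>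
      (\<exists>!h. h \<in> Hom C (Cod C i') T \<and> h \<cdot>\<^bsub>C\<^esub> f' = u \<and> h \<cdot>\<^bsub>C\<^esub> i' = v))"

text \<open>The square \<open>d \<cdot> f' = f \<cdot> d'\<close> is a pullback of \<open>d\<close> and \<open>f\<close>;
  \<open>d'\<close> is the pullback of \<open>d\<close> along \<open>f\<close>.\<close>

definition is_pullback ::
  "('o, 'm, 'z) category_scheme \<Rightarrow> 'm \<Rightarrow> 'm \<Rightarrow> 'm \<Rightarrow> 'm \<Rightarrow> bool" where
  "is_pullback C d f d' f' \<longleftrightarrow>
    d \<in> Arr C \<and> f \<in> Arr C \<and> d' \<in> Arr C \<and> f' \<in> Arr C \<and>
    Cod C d = Cod C f \<and> Cod C d' = Dom C f \<and> Cod C f' = Dom C d \<and> Dom C d' = Dom C f' \<and>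
    d \<cdot>\<^bsub>C\<^esub> f' = f \<cdot>\<^bsub>C\<^esub> d' \<and>
    (\<forall>T \<in> Obj C. \<forall>u \<in> Hom C T (Dom C d). \<forall>v \<in> Hom C T (Dom C f).
      d \<cdot>\<^bsub>C\<^esub> u = f \<cdot>\<^bsub>C\<^esub> v \<longrightarrow>
      (\<exists>!h. h \<in> Hom C T (Dom C d') \<and> f' \<cdot>\<^bsub>C\<^esub> h = u \<and> d' \<cdot>\<^bsub>C\<^esub> h = v))"


section \<open>Additive categories\<close>

record ('o, 'm) additive_category = "('o, 'm) category" +
  Zero_arr :: "'o \<Rightarrow> 'o \<Rightarrow> 'm"
  Plus_arr :: "'m \<Rightarrow> 'm \<Rightarrow> 'm" (infixl "\<boxplus>\<index>" 65)

definition Hom_group ::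
  "('o, 'm, 'z) additive_category_scheme \<Rightarrow> 'o \<Rightarrow> 'o \<Rightarrow> 'm monoid" where
  "Hom_group C A B = \<lparr>carrier = Hom C A B, mult = Plus_arr C, one = Zero_arr C A B\<rparr>"

definition is_zero_object :: "('o, 'm, 'z) additive_category_scheme \<Rightarrow> 'o \<Rightarrow> bool" where
  "is_zero_object C Z \<longleftrightarrow> Z \<in> Obj C \<and>
    (\<forall>A \<in> Obj C. (\<exists>!f. f \<in> Hom C A Z) \<and> (\<exists>!f. f \<in> Hom C Z A))"

definition is_biproduct ::
  "('o, 'm, 'z) additive_category_scheme \<Rightarrow> 'o \<Rightarrow> 'o \<Rightarrow> 'o \<Rightarrow> 'm \<Rightarrow> 'm \<Rightarrow> 'm \<Rightarrow> 'm \<Rightarrow> bool" where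
  "is_biproduct C A B P i1 i2 p1 p2 \<longleftrightarrow>
    A \<in> Obj C \<and> B \<in> Obj C \<and> P \<in> Obj C \<and>
    i1 \<in> Hom C A P \<and> i2 \<in> Hom C B P \<and> p1 \<in> Hom C P A \<and> p2 \<in> Hom C P B \<and>
    p1 \<cdot>\<^bsub>C\<^esub> i1 = Ident C A \<and> p2 \<cdot>\<^bsub>C\<^esub> i2 = Ident C B \<and>
    p1 \<cdot>\<^bsub>C\<^esub> i2 = Zero_arr C B A \<and> p2 \<cdot>\<^bsub>C\<^esub> i1 = Zero_arr C A B \<and>
    (i1 \<cdot>\<^bsub>C\<^esub> p1) \<boxplus>\<^bsub>C\<^esub> (i2 \<cdot>\<^bsub>C\<^esub> p2) = Ident C P"

locale additive_category = category C
  for C :: "('o, 'm, 'z) additive_category_scheme" (structure) +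
  assumes Hom_comm_group: "A \<in> Obj C \<Longrightarrow> B \<in> Obj C \<Longrightarrow> comm_group (Hom_group C A B)"
    and Comp_Plus_left: "f \<in> Hom C A B \<Longrightarrow> g \<in> Hom C B D \<Longrightarrow> g' \<in> Hom C B D \<Longrightarrow>
      (g \<boxplus> g') \<cdot> f = (g \<cdot> f) \<boxplus> (g' \<cdot> f)"
    and Comp_Plus_right: "f \<in> Hom C A B \<Longrightarrow> f' \<in> Hom C A B \<Longrightarrow> g \<in> Hom C B D \<Longrightarrow>
      g \<cdot> (f \<boxplus> f') = (g \<cdot> f) \<boxplus> (g \<cdot> f')"
    and ex_zero_object: "\<exists>Z. is_zero_object C Z"
    and ex_biproduct: "A \<in> Obj C \<Longrightarrow> B \<in> Obj C \<Longrightarrow>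
      \<exists>P i1 i2 p1 p2. is_biproduct C A B P i1 i2 p1 p2"

definition is_kernel :: "('o, 'm, 'z) additive_category_scheme \<Rightarrow> 'm \<Rightarrow> 'm \<Rightarrow> bool" where
  "is_kernel C k f \<longleftrightarrow> k \<in> Arr C \<and> f \<in> Arr C \<and> Cod C k = Dom C f \<and>
    f \<cdot>\<^bsub>C\<^esub> k = Zero_arr C (Dom C k) (Cod C f) \<and>
    (\<forall>T \<in> Obj C. \<forall>u \<in> Hom C T (Dom C f). f \<cdot>\<^bsub>C\<^esub> u = Zero_arr C T (Cod C f) \<longrightarrow>
      (\<exists>!h. h \<in> Hom C T (Dom C k) \<and> k \<cdot>\<^bsub>C\<^esub> h = u))"

definition is_cokernel :: "('o, 'm, 'z) additive_category_scheme \<Rightarrow> 'm \<Rightarrow> 'm \<Rightarrow> bool" where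
  "is_cokernel C c f \<longleftrightarrow> c \<in> Arr C \<and> f \<in> Arr C \<and> Dom C c = Cod C f \<and>
    c \<cdot>\<^bsub>C\<^esub> f = Zero_arr C (Dom C f) (Cod C c) \<and>
    (\<forall>T \<in> Obj C. \<forall>u \<in> Hom C (Cod C f) T. u \<cdot>\<^bsub>C\<^esub> f = Zero_arr C (Dom C f) T \<longrightarrow>
      (\<exists>!h. h \<in> Hom C (Cod C c) T \<and> h \<cdot>\<^bsub>C\<^esub> c = u))"


section \<open>Exact categories\<close>

text \<open>A conflation \<open>X \<rightarrow> Y \<rightarrow> Z\<close> is recorded as the pair \<open>(i, d)\<close> of its inflation and its
  deflation.\<close>

record ('o, 'm) exact_category = "('o, 'm) additive_category" +
  Conflations :: "('m \<times> 'm) set"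

definition Inflations :: "('o, 'm, 'z) exact_category_scheme \<Rightarrow> 'm set" where
  "Inflations C = {i. \<exists>d. (i, d) \<in> Conflations C}"

definition Deflations :: "('o, 'm, 'z) exact_category_scheme \<Rightarrow> 'm set" where
  "Deflations C = {d. \<exists>i. (i, d) \<in> Conflations C}"

text \<open>Quillen's exact categories, in the axiomatization of Keller and Buehler. Quillen's further
  axioms (split sequences are conflations, the obscure axiom) follow from these.\<close>

locale exact_category = additive_category C
  for C :: "('o, 'm, 'z) exact_category_scheme" (structure) +
  assumes conflation_kernel_cokernel:
      "(i, d) \<in> Conflations C \<Longrightarrow> is_kernel C i d \<and> is_cokernel C d i"
    and conflation_iso_closed:
      "(i, d) \<in> Conflations C \<Longrightarrow> i' \<in> Arr C \<Longrightarrow> d' \<in> Arr C \<Longrightarrow> Cod C i' = Dom C d' \<Longrightarrow>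
       a \<in> Hom C (Dom C i) (Dom C i') \<Longrightarrow> b \<in> Hom C (Cod C i) (Cod C i') \<Longrightarrow>
       c \<in> Hom C (Cod C d) (Cod C d') \<Longrightarrow> is_iso C a \<Longrightarrow> is_iso C b \<Longrightarrow> is_iso C c \<Longrightarrow>
       b \<cdot> i = i' \<cdot> a \<Longrightarrow> c \<cdot> d = d' \<cdot> b \<Longrightarrow> (i', d') \<in> Conflations C"
    and Ident_inflation: "A \<in> Obj C \<Longrightarrow> Ident C A \<in> Inflations C"
    and Ident_deflation: "A \<in> Obj C \<Longrightarrow> Ident C A \<in> Deflations C"
    and inflation_Comp: "i \<in> Inflations C \<Longrightarrow> j \<in> Inflations C \<Longrightarrow> Cod C i = Dom C j \<Longrightarrow>
      j \<cdot> i \<in> Inflations C"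
    and deflation_Comp: "d \<in> Deflations C \<Longrightarrow> e \<in> Deflations C \<Longrightarrow> Cod C d = Dom C e \<Longrightarrow>
      e \<cdot> d \<in> Deflations C"
    and inflation_pushout: "i \<in> Inflations C \<Longrightarrow> f \<in> Arr C \<Longrightarrow> Dom C f = Dom C i \<Longrightarrow>
      \<exists>i' f'. is_pushout C i f i' f' \<and> i' \<in> Inflations C"
    and deflation_pullback: "d \<in> Deflations C \<Longrightarrow> f \<in> Arr C \<Longrightarrow> Cod C f = Cod C d \<Longrightarrow>
      \<exists>d' f'. is_pullback C d f d' f' \<and> d' \<in> Deflations C"

locale weakly_idempotent_complete_exact_category = exact_category +
  assumes split_epi_deflation: "split_epi C p \<Longrightarrow> p \<in> Deflations C"


section \<open>Yoneda Ext\<close>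

definition Extensions :: "('o, 'm, 'z) exact_category_scheme \<Rightarrow> 'o \<Rightarrow> 'o \<Rightarrow> ('m \<times> 'm) set" where
  "Extensions C A B = {(i, d) \<in> Conflations C. Dom C i = B \<and> Cod C d = A}"

text \<open>By the five lemma, requiring \<open>h\<close> to be an isomorphism is no restriction in an exact category.\<close>

definition ext_equiv ::
  "('o, 'm, 'z) exact_category_scheme \<Rightarrow> 'o \<Rightarrow> 'o \<Rightarrow> (('m \<times> 'm) \<times> ('m \<times> 'm)) set" where
  "ext_equiv C A B = {((i, d), (i', d')).
    (i, d) \<in> Extensions C A B \<and> (i', d') \<in> Extensions C A B \<and>
    (\<exists>h \<in> Hom C (Cod C i) (Cod C i'). is_iso C h \<and> h \<cdot>\<^bsub>C\<^esub> i = i' \<and> d' \<cdot>\<^bsub>C\<^esub> h = d)}"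

definition Ext1 ::
  "('o, 'm, 'z) exact_category_scheme \<Rightarrow> 'o \<Rightarrow> 'o \<Rightarrow> ('m \<times> 'm) set set" where
  "Ext1 C A B = Extensions C A B // ext_equiv C A B"

text \<open>The zero element of \<open>Ext1 C A B\<close>: the class of \<open>B \<rightarrow> B \<oplus> A \<rightarrow> A\<close>. As \<open>B \<oplus> A\<close> is only
  determined up to isomorphism, the image is taken over all choices; they are all equivalent.\<close>

definition Ext1_zero ::
  "('o, 'm, 'z) exact_category_scheme \<Rightarrow> 'o \<Rightarrow> 'o \<Rightarrow> ('m \<times> 'm) set" where
  "Ext1_zero C A B = ext_equiv C A B `` {(i1, p2). \<exists>P i2 p1. is_biproduct C B A P i1 i2 p1 p2}"


section \<open>Cotorsion pairs\<close>

definition cotorsion_pair ::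
  "('o, 'm, 'z) exact_category_scheme \<Rightarrow> 'o set \<Rightarrow> 'o set \<Rightarrow> bool" where
  "cotorsion_pair C \<C> \<F> \<longleftrightarrow> \<C> \<subseteq> Obj C \<and> \<F> \<subseteq> Obj C \<and>
    \<C> = {A \<in> Obj C. \<forall>F \<in> \<F>. Ext1 C A F = {Ext1_zero C A F}} \<and>
    \<F> = {B \<in> Obj C. \<forall>D \<in> \<C>. Ext1 C D B = {Ext1_zero C D B}}"

definition complete_cotorsion_pair ::
  "('o, 'm, 'z) exact_category_scheme \<Rightarrow> 'o set \<Rightarrow> 'o set \<Rightarrow> bool" where
  "complete_cotorsion_pair C \<C> \<F> \<longleftrightarrow> cotorsion_pair C \<C> \<F> \<and>
    (\<forall>A \<in> Obj C.
      (\<exists>(i, d) \<in> Conflations C. Dom C i \<in> \<F> \<and> Cod C i \<in> \<C> \<and> Cod C d = A) \<and>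
      (\<exists>(i, d) \<in> Conflations C. Dom C i = A \<and> Cod C i \<in> \<F> \<and> Cod C d \<in> \<C>))"

definition hereditary_cotorsion_pair ::
  "('o, 'm, 'z) exact_category_scheme \<Rightarrow> 'o set \<Rightarrow> 'o set \<Rightarrow> bool" where
  "hereditary_cotorsion_pair C \<C> \<F> \<longleftrightarrow> cotorsion_pair C \<C> \<F> \<and>
    (\<forall>d k. d \<in> Deflations C \<and> Dom C d \<in> \<C> \<and> Cod C d \<in> \<C> \<and> is_kernel C k d \<longrightarrow>
      Dom C k \<in> \<C>) \<and>
    (\<forall>i c. i \<in> Inflations C \<and> Dom C i \<in> \<F> \<and> Cod C i \<in> \<F> \<and> is_cokernel C c i \<longrightarrow>
      Cod C c \<in> \<F>)"


section \<open>Model structures\<close>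

text \<open>\<open>f\<close> is a retract of \<open>g\<close> in the category of morphisms, via \<open>(a, c): f \<rightarrow> g\<close> and
  \<open>(b, d): g \<rightarrow> f\<close>.\<close>

definition is_retract :: "('o, 'm, 'z) category_scheme \<Rightarrow> 'm \<Rightarrow> 'm \<Rightarrow> bool" where
  "is_retract C f g \<longleftrightarrow> f \<in> Arr C \<and> g \<in> Arr C \<and>
    (\<exists>a \<in> Hom C (Dom C f) (Dom C g). \<exists>b \<in> Hom C (Dom C g) (Dom C f).
     \<exists>c \<in> Hom C (Cod C f) (Cod C g). \<exists>d \<in> Hom C (Cod C g) (Cod C f).
      b \<cdot>\<^bsub>C\<^esub> a = Ident C (Dom C f) \<and> d \<cdot>\<^bsub>C\<^esub> c = Ident C (Cod C f) \<and>
      g \<cdot>\<^bsub>C\<^esub> a = c \<cdot>\<^bsub>C\<^esub> f \<and> f \<cdot>\<^bsub>C\<^esub> b = d \<cdot>\<^bsub>C\<^esub> g)"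

text \<open>\<open>i\<close> has the left lifting property with respect to \<open>p\<close>, i.e. \<open>p\<close> has the right lifting
  property with respect to \<open>i\<close>.\<close>

definition has_lifting :: "('o, 'm, 'z) category_scheme \<Rightarrow> 'm \<Rightarrow> 'm \<Rightarrow> bool" where
  "has_lifting C i p \<longleftrightarrow>
    (\<forall>u \<in> Hom C (Dom C i) (Dom C p). \<forall>v \<in> Hom C (Cod C i) (Cod C p).
      p \<cdot>\<^bsub>C\<^esub> u = v \<cdot>\<^bsub>C\<^esub> i \<longrightarrow>
      (\<exists>h \<in> Hom C (Cod C i) (Dom C p). h \<cdot>\<^bsub>C\<^esub> i = u \<and> p \<cdot>\<^bsub>C\<^esub> h = v))"

locale model_structure = category C
  for C :: "('o, 'm, 'z) category_scheme" (structure) +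
  fixes CoFib Fib Weq :: "'m set"
  assumes CoFib_Arr: "CoFib \<subseteq> Arr C"
    and Fib_Arr: "Fib \<subseteq> Arr C"
    and Weq_Arr: "Weq \<subseteq> Arr C"
    and two_out_of_three: "f \<in> Arr C \<Longrightarrow> g \<in> Arr C \<Longrightarrow> Cod C f = Dom C g \<Longrightarrow>
      (f \<in> Weq \<and> g \<in> Weq \<longrightarrow> g \<cdot> f \<in> Weq) \<and>
      (f \<in> Weq \<and> g \<cdot> f \<in> Weq \<longrightarrow> g \<in> Weq) \<and>
      (g \<in> Weq \<and> g \<cdot> f \<in> Weq \<longrightarrow> f \<in> Weq)"
    and CoFib_retract: "is_retract C f g \<Longrightarrow> g \<in> CoFib \<Longrightarrow> f \<in> CoFib"
    and Fib_retract: "is_retract C f g \<Longrightarrow> g \<in> Fib \<Longrightarrow> f \<in> Fib"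
    and Weq_retract: "is_retract C f g \<Longrightarrow> g \<in> Weq \<Longrightarrow> f \<in> Weq"
    and CoFib_lifting: "i \<in> CoFib \<Longrightarrow> p \<in> Fib \<inter> Weq \<Longrightarrow> has_lifting C i p"
    and Fib_lifting: "i \<in> CoFib \<inter> Weq \<Longrightarrow> p \<in> Fib \<Longrightarrow> has_lifting C i p"
    and factorization_trivial_CoFib: "f \<in> Arr C \<Longrightarrow>
      \<exists>i p. i \<in> CoFib \<inter> Weq \<and> p \<in> Fib \<and> Dom C p = Cod C i \<and> f = p \<cdot> i"
    and factorization_trivial_Fib: "f \<in> Arr C \<Longrightarrow>
      \<exists>j q. j \<in> CoFib \<and> q \<in> Fib \<inter> Weq \<and> Dom C q = Cod C j \<and> f = q \<cdot> j"


section \<open>The classes of morphisms associated with a pair of classes of objects\<close>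

text \<open>Here \<open>\<omega> = \<X> \<inter> \<Y>\<close>.\<close>

definition CoFib_omega ::
  "('o, 'm, 'z) exact_category_scheme \<Rightarrow> 'o set \<Rightarrow> 'o set \<Rightarrow> 'm set" where
  "CoFib_omega C \<X> \<Y> = {f \<in> Inflations C. \<exists>c. is_cokernel C c f \<and> Cod C c \<in> \<X>}"

definition Fib_omega ::
  "('o, 'm, 'z) exact_category_scheme \<Rightarrow> 'o set \<Rightarrow> 'o set \<Rightarrow> 'm set" where
  "Fib_omega C \<X> \<Y> = {f \<in> Arr C. \<forall>W \<in> \<X> \<inter> \<Y>.
    (\<lambda>g. f \<cdot>\<^bsub>C\<^esub> g) ` Hom C W (Dom C f) = Hom C W (Cod C f)}"

text \<open>The morphism \<open>(f, t): A \<oplus> W \<rightarrow> B\<close> is \<open>f \<cdot> p1 \<boxplus> t \<cdot> p2\<close>.\<close>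

definition Weq_omega ::
  "('o, 'm, 'z) exact_category_scheme \<Rightarrow> 'o set \<Rightarrow> 'o set \<Rightarrow> 'm set" where
  "Weq_omega C \<X> \<Y> = {f \<in> Arr C.
    \<exists>W \<in> \<X> \<inter> \<Y>. \<exists>t \<in> Hom C W (Cod C f).
    \<exists>P i1 i2 p1 p2. is_biproduct C (Dom C f) W P i1 i2 p1 p2 \<and>
      (let h = (f \<cdot>\<^bsub>C\<^esub> p1) \<boxplus>\<^bsub>C\<^esub> (t \<cdot>\<^bsub>C\<^esub> p2) in
        h \<in> Deflations C \<and> (\<exists>k. is_kernel C k h \<and> Dom C k \<in> \<Y>))}"

end

theory Submission
  imports Defs
begin

text \<open>A deflation with kernel in \<open>\<Y>\<close> is a weak equivalence, and if \<open>Z \<rightarrow> 0\<close> is a weak equivalence,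
  then \<open>Z\<close> is a direct summand of an object of \<open>\<Y>\<close>. So for a conflation \<open>Y\<^sub>1 \<rightarrow> Y\<^sub>2 \<rightarrow> Z\<close> with
  \<open>Y\<^sub>1, Y\<^sub>2 \<in> \<Y>\<close>, two out of three for \<open>Y\<^sub>2 \<rightarrow> Z \<rightarrow> 0\<close> gives \<open>Z \<in> \<Y>\<close>.

  For a conflation \<open>K \<rightarrow> X\<^sub>1 \<rightarrow> X\<^sub>2\<close> with \<open>X\<^sub>1, X\<^sub>2 \<in> \<X>\<close> and an extension \<open>Y \<rightarrow> E \<rightarrow> K\<close> with \<open>Y \<in> \<Y>\<close>,
  embed \<open>E\<close> into some \<open>F \<in> \<Y>\<close> with cokernel in \<open>\<X>\<close>. Then \<open>F/Y \<in> \<Y>\<close> by the first part, so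
  \<open>K = E/Y \<rightarrow> F/Y\<close> extends to \<open>X\<^sub>1 \<rightarrow> F/Y\<close>, which lifts to \<open>X\<^sub>1 \<rightarrow> F\<close>. Its restriction to \<open>K\<close> lands in \<open>E\<close>
  and splits the extension.\<close>

section \<open>Additive categories\<close>

context category
begin

lemma HomD: "f \<in> Hom C A B \<Longrightarrow> f \<in> Arr C \<and> Dom C f = A \<and> Cod C f = B \<and> A \<in> Obj C \<and> B \<in> Obj C"
  by (auto simp: Hom_def Dom_in_Obj Cod_in_Obj)

lemma is_isoI:
  assumes "f \<in> Hom C A B" "g \<in> Hom C B A" "g \<cdot> f = Ident C A" "f \<cdot> g = Ident C B"
  shows "is_iso C f"
  using assms HomD by (auto simp: is_iso_def)

lemma is_iso_Ident: "A \<in> Obj C \<Longrightarrow> is_iso C (Ident C A)"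
  by (rule is_isoI[OF Ident_in_Hom Ident_in_Hom])
    (use Comp_Ident_left[OF Ident_in_Hom] in simp_all)

end

context additive_category
begin

section \<open>Group structure on hom sets and zero morphisms\<close>

lemma Zero_in_Hom:
  assumes "A \<in> Obj C" "B \<in> Obj C"
  shows "Zero_arr C A B \<in> Hom C A B"
proof -
  interpret comm_group "Hom_group C A B" by (rule Hom_comm_group[OF assms])
  show ?thesis using one_closed by (simp add: Hom_group_def)
qed

lemma Plus_in_Hom:
  assumes "f \<in> Hom C A B" "g \<in> Hom C A B"
  shows "f \<boxplus> g \<in> Hom C A B"
proof -
  interpret comm_group "Hom_group C A B" using HomD[OF assms(1)] by (intro Hom_comm_group) auto
  show ?thesis using m_closed[of f g] assms by (simp add: Hom_group_def)
qed

lemma Plus_Zero_right: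
  assumes "f \<in> Hom C A B"
  shows "f \<boxplus> Zero_arr C A B = f"
proof -
  interpret comm_group "Hom_group C A B" using HomD[OF assms] by (intro Hom_comm_group) auto
  show ?thesis using r_one[of f] assms by (simp add: Hom_group_def)
qed

lemma Plus_Zero_left:
  assumes "f \<in> Hom C A B"
  shows "Zero_arr C A B \<boxplus> f = f"
proof -
  interpret comm_group "Hom_group C A B" using HomD[OF assms] by (intro Hom_comm_group) auto
  show ?thesis using l_one[of f] assms by (simp add: Hom_group_def)
qed

text \<open>Cancellation in the abelian group of morphisms. The category record carries no negation,
  so this replaces subtracting \<open>g\<close> on both sides.\<close>

lemma Plus_right_cancel:
  assumes "f \<in> Hom C A B" "g \<in> Hom C A B" "f \<boxplus> g = g"
  shows "f = Zero_arr C A B"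
proof -
  interpret comm_group "Hom_group C A B" using HomD[OF assms(1)] by (intro Hom_comm_group) auto
  show ?thesis using r_cancel_one'[of g f] assms by (auto simp: Hom_group_def)
qed

text \<open>Stands in for \<open>f - g\<close>; it supplies complements of endomorphisms such as
  identity minus \<open>s \<cdot> d\<close>.\<close>

lemma ex_difference:
  assumes "f \<in> Hom C A B" "g \<in> Hom C A B"
  obtains h where "h \<in> Hom C A B" "h \<boxplus> g = f"
proof -
  interpret comm_group "Hom_group C A B" using HomD[OF assms(1)] by (intro Hom_comm_group) auto
  define h where "h = f \<otimes>\<^bsub>Hom_group C A B\<^esub> inv\<^bsub>Hom_group C A B\<^esub> g"
  have "f \<in> carrier (Hom_group C A B)" "g \<in> carrier (Hom_group C A B)"
    using assms by (auto simp: Hom_group_def)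
  then have "h \<in> carrier (Hom_group C A B)" "h \<otimes>\<^bsub>Hom_group C A B\<^esub> g = f"
    unfolding h_def by (auto simp: m_assoc)
  then show ?thesis using that by (simp add: Hom_group_def)
qed

text \<open>By distributivity the composite added to itself gives itself again, and in a group only
  the zero element does that.\<close>

lemma Zero_Comp:
  assumes "f \<in> Hom C A B" "D \<in> Obj C"
  shows "Zero_arr C B D \<cdot> f = Zero_arr C A D"
proof (rule Plus_right_cancel)
  have Z: "Zero_arr C B D \<in> Hom C B D" using assms HomD Zero_in_Hom by blast
  show "Zero_arr C B D \<cdot> f \<in> Hom C A D" "Zero_arr C B D \<cdot> f \<in> Hom C A D"
    using Comp_in_Hom assms Z by auto
  show "Zero_arr C B D \<cdot> f \<boxplus> Zero_arr C B D \<cdot> f = Zero_arr C B D \<cdot> f"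
    using Comp_Plus_left[OF assms(1) Z Z] Plus_Zero_left[OF Z] by simp
qed

lemma Comp_Zero:
  assumes "g \<in> Hom C B D" "A \<in> Obj C"
  shows "g \<cdot> Zero_arr C A B = Zero_arr C A D"
proof (rule Plus_right_cancel)
  have Z: "Zero_arr C A B \<in> Hom C A B" using assms HomD Zero_in_Hom by blast
  show "g \<cdot> Zero_arr C A B \<in> Hom C A D" "g \<cdot> Zero_arr C A B \<in> Hom C A D"
    using Comp_in_Hom assms Z by auto
  show "g \<cdot> Zero_arr C A B \<boxplus> g \<cdot> Zero_arr C A B = g \<cdot> Zero_arr C A B"
    using Comp_Plus_right[OF Z Z assms(1)] Plus_Zero_left[OF Z] by simp
qed

lemma zero_object_Hom_eq:
  assumes "is_zero_object C Z"
  shows "f \<in> Hom C A Z \<Longrightarrow> g \<in> Hom C A Z \<Longrightarrow> f = g" "f \<in> Hom C Z A \<Longrightarrow> g \<in> Hom C Z A \<Longrightarrow> f = g"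
proof -
  have "\<exists>!f. f \<in> Hom C A Z" "\<exists>!f. f \<in> Hom C Z A" if "A \<in> Obj C"
    using assms that by (auto simp: is_zero_object_def)
  then show "f \<in> Hom C A Z \<Longrightarrow> g \<in> Hom C A Z \<Longrightarrow> f = g" "f \<in> Hom C Z A \<Longrightarrow> g \<in> Hom C Z A \<Longrightarrow> f = g"
    using HomD by blast+
qed

section \<open>Kernels and cokernels\<close>

text \<open>Rewrites the universal property in terms of named objects, so that unfolding it leaves
  no \<open>Dom\<close> and \<open>Cod\<close> terms behind.\<close>

lemma is_kernel_iff:
  assumes "k \<in> Hom C K A" "f \<in> Hom C A B"
  shows "is_kernel C k f \<longleftrightarrow> f \<cdot> k = Zero_arr C K B \<and>
    (\<forall>T \<in> Obj C. \<forall>u \<in> Hom C T A. f \<cdot> u = Zero_arr C T B \<longrightarrow>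
      (\<exists>!h. h \<in> Hom C T K \<and> k \<cdot> h = u))"
  using HomD[OF assms(1)] HomD[OF assms(2)] by (simp add: is_kernel_def)

lemma is_cokernel_iff:
  assumes "c \<in> Hom C B K" "f \<in> Hom C A B"
  shows "is_cokernel C c f \<longleftrightarrow> c \<cdot> f = Zero_arr C A K \<and>
    (\<forall>T \<in> Obj C. \<forall>u \<in> Hom C B T. u \<cdot> f = Zero_arr C A T \<longrightarrow>
      (\<exists>!h. h \<in> Hom C K T \<and> h \<cdot> c = u))"
  using HomD[OF assms(1)] HomD[OF assms(2)] by (simp add: is_cokernel_def)

lemma kernel_factor:
  assumes "is_kernel C k f" "k \<in> Hom C K A" "f \<in> Hom C A B" "u \<in> Hom C T A" "f \<cdot> u = Zero_arr C T B"
  obtains h where "h \<in> Hom C T K" "k \<cdot> h = u"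
proof -
  have "T \<in> Obj C" using HomD[OF assms(4)] by simp
  then show ?thesis
    using assms(1)[unfolded is_kernel_iff[OF assms(2,3)]] assms(4,5) that by meson
qed

lemma cokernel_factor:
  assumes "is_cokernel C c f" "c \<in> Hom C B K" "f \<in> Hom C A B" "u \<in> Hom C B T" "u \<cdot> f = Zero_arr C A T"
  obtains h where "h \<in> Hom C K T" "h \<cdot> c = u"
proof -
  have "T \<in> Obj C" using HomD[OF assms(4)] by simp
  then show ?thesis
    using assms(1)[unfolded is_cokernel_iff[OF assms(2,3)]] assms(4,5) that by meson
qed

text \<open>Both \<open>x\<close> and \<open>y\<close> factor the morphism
  \<open>k \<cdot> x\<close> through \<open>k\<close>, and \<open>f\<close> kills that morphism, so
  the uniqueness half of the universal property identifies them.\<close>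

lemma kernel_mono:
  assumes "is_kernel C k f" "k \<in> Hom C K A" "x \<in> Hom C T K" "y \<in> Hom C T K" "k \<cdot> x = k \<cdot> y"
  shows "x = y"
proof -
  define B where "B = Cod C f"
  have f: "f \<in> Hom C A B"
    using assms(1) HomD[OF assms(2)] by (auto simp: B_def is_kernel_def Hom_def)
  have "f \<cdot> (k \<cdot> x) = (f \<cdot> k) \<cdot> x" using Comp_assoc[OF assms(3,2) f] by simp
  also have "\<dots> = Zero_arr C T B"
    using assms(1) is_kernel_iff[OF assms(2) f] Zero_Comp assms(3) HomD[OF f] by auto
  finally have "\<exists>!h. h \<in> Hom C T K \<and> k \<cdot> h = k \<cdot> x"
    using assms(1) is_kernel_iff[OF assms(2) f] Comp_in_Hom[OF assms(3,2)] HomD[OF assms(3)] by simp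
  then show ?thesis using assms(3-5) by metis
qed

lemma cokernel_epi:
  assumes "is_cokernel C c f" "c \<in> Hom C B K" "x \<in> Hom C K T" "y \<in> Hom C K T" "x \<cdot> c = y \<cdot> c"
  shows "x = y"
proof -
  define A where "A = Dom C f"
  have f: "f \<in> Hom C A B"
    using assms(1) HomD[OF assms(2)] by (auto simp: A_def is_cokernel_def Hom_def)
  have "(x \<cdot> c) \<cdot> f = x \<cdot> (c \<cdot> f)" using Comp_assoc[OF f assms(2,3)] by simp
  also have "\<dots> = Zero_arr C A T"
    using assms(1) is_cokernel_iff[OF assms(2) f] Comp_Zero assms(3) HomD[OF f] by auto
  finally have "\<exists>!h. h \<in> Hom C K T \<and> h \<cdot> c = x \<cdot> c"
    using assms(1) is_cokernel_iff[OF assms(2) f] Comp_in_Hom[OF assms(2,3)] HomD[OF assms(3)] by simp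
  then show ?thesis using assms(3-5) by metis
qed

text \<open>Each kernel factors through the other, and the two factors are mutually inverse because
  kernels are monic.\<close>

lemma kernel_unique:
  assumes "is_kernel C k f" "is_kernel C k' f"
    and k: "k \<in> Hom C K A" and k': "k' \<in> Hom C K' A" and f: "f \<in> Hom C A B"
  obtains a where "a \<in> Hom C K K'" "is_iso C a" "k' \<cdot> a = k"
proof -
  have z: "f \<cdot> k = Zero_arr C K B" "f \<cdot> k' = Zero_arr C K' B"
    using assms is_kernel_iff by blast+
  obtain a where a: "a \<in> Hom C K K'" "k' \<cdot> a = k"
    using kernel_factor[OF assms(2) k' f k z(1)] .
  obtain b where b: "b \<in> Hom C K' K" "k \<cdot> b = k'"
    using kernel_factor[OF assms(1) k f k' z(2)] .
  have "b \<cdot> a = Ident C K"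
  proof (rule kernel_mono[OF assms(1) k])
    show "b \<cdot> a \<in> Hom C K K" "Ident C K \<in> Hom C K K"
      using a b Comp_in_Hom Ident_in_Hom HomD[OF k] by auto
    show "k \<cdot> b \<cdot> a = k \<cdot> Ident C K"
      using Comp_assoc[OF a(1) b(1) k] a b Comp_Ident_right[OF k] by simp
  qed
  moreover have "a \<cdot> b = Ident C K'"
  proof (rule kernel_mono[OF assms(2) k'])
    show "a \<cdot> b \<in> Hom C K' K'" "Ident C K' \<in> Hom C K' K'"
      using a b Comp_in_Hom Ident_in_Hom HomD[OF k'] by auto
    show "k' \<cdot> a \<cdot> b = k' \<cdot> Ident C K'"
      using Comp_assoc[OF b(1) a(1) k'] a b Comp_Ident_right[OF k'] by simp
  qed
  ultimately show ?thesis using that a b is_isoI by blast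
qed

lemma cokernel_unique:
  assumes "is_cokernel C c f" "is_cokernel C c' f"
    and c: "c \<in> Hom C B K" and c': "c' \<in> Hom C B K'" and f: "f \<in> Hom C A B"
  obtains a where "a \<in> Hom C K K'" "is_iso C a" "a \<cdot> c = c'"
proof -
  have z: "c \<cdot> f = Zero_arr C A K" "c' \<cdot> f = Zero_arr C A K'"
    using assms is_cokernel_iff by blast+
  obtain a where a: "a \<in> Hom C K K'" "a \<cdot> c = c'"
    using cokernel_factor[OF assms(1) c f c' z(2)] .
  obtain b where b: "b \<in> Hom C K' K" "b \<cdot> c' = c"
    using cokernel_factor[OF assms(2) c' f c z(1)] .
  have "b \<cdot> a = Ident C K"
  proof (rule cokernel_epi[OF assms(1) c])
    show "b \<cdot> a \<in> Hom C K K" "Ident C K \<in> Hom C K K"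
      using a b Comp_in_Hom Ident_in_Hom HomD[OF c] by auto
    show "(b \<cdot> a) \<cdot> c = Ident C K \<cdot> c"
      using Comp_assoc[OF c a(1) b(1)] a b Comp_Ident_left[OF c] by simp
  qed
  moreover have "a \<cdot> b = Ident C K'"
  proof (rule cokernel_epi[OF assms(2) c'])
    show "a \<cdot> b \<in> Hom C K' K'" "Ident C K' \<in> Hom C K' K'"
      using a b Comp_in_Hom Ident_in_Hom HomD[OF c'] by auto
    show "(a \<cdot> b) \<cdot> c' = Ident C K' \<cdot> c'"
      using Comp_assoc[OF c' b(1) a(1)] a b Comp_Ident_left[OF c'] by simp
  qed
  ultimately show ?thesis using that a b is_isoI by blast
qed

section \<open>Biproducts\<close>

text \<open>Splitting \<open>u\<close> as
  \<open>i1 \<cdot> p1 \<cdot> u \<boxplus> i2 \<cdot> p2 \<cdot> u\<close>, the second summand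
  vanishes when \<open>p2\<close> kills \<open>u\<close>. The factor must then be
  \<open>p1 \<cdot> u\<close>, as \<open>p1\<close> is a retraction of \<open>i1\<close>.\<close>

lemma biproduct_kernel:
  assumes "is_biproduct C A B P i1 i2 p1 p2"
  shows "is_kernel C i1 p2"
proof -
  have i1: "i1 \<in> Hom C A P" and i2: "i2 \<in> Hom C B P" and p1: "p1 \<in> Hom C P A" and p2: "p2 \<in> Hom C P B"
    and e: "p1 \<cdot> i1 = Ident C A" "p2 \<cdot> i1 = Zero_arr C A B"
    and sum: "(i1 \<cdot> p1) \<boxplus> (i2 \<cdot> p2) = Ident C P"
    using assms by (auto simp: is_biproduct_def)
  show ?thesis unfolding is_kernel_iff[OF i1 p2]
  proof (intro conjI ballI impI)
    fix T u assume T: "T \<in> Obj C" and u: "u \<in> Hom C T P" and z: "p2 \<cdot> u = Zero_arr C T B"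
    have ip1: "i1 \<cdot> p1 \<in> Hom C P P" and ip2: "i2 \<cdot> p2 \<in> Hom C P P"
      using Comp_in_Hom i1 i2 p1 p2 by blast+
    have pu: "p1 \<cdot> u \<in> Hom C T A" using Comp_in_Hom[OF u p1] .
    have "u = (i1 \<cdot> p1) \<cdot> u \<boxplus> (i2 \<cdot> p2) \<cdot> u"
      using Comp_Plus_left[OF u ip1 ip2] sum Comp_Ident_left[OF u] by simp
    also have "(i2 \<cdot> p2) \<cdot> u = Zero_arr C T P"
      using Comp_assoc[OF u p2 i2] z Comp_Zero[OF i2 T] by simp
    also have "(i1 \<cdot> p1) \<cdot> u = i1 \<cdot> (p1 \<cdot> u)" using Comp_assoc[OF u p1 i1] .
    also have "i1 \<cdot> (p1 \<cdot> u) \<boxplus> Zero_arr C T P = i1 \<cdot> (p1 \<cdot> u)"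
      using Plus_Zero_right[OF Comp_in_Hom[OF pu i1]] .
    finally have "i1 \<cdot> (p1 \<cdot> u) = u" by simp
    moreover have "h = p1 \<cdot> u" if "h \<in> Hom C T A" "i1 \<cdot> h = u" for h
      using that Comp_assoc[OF that(1) i1 p1] e Comp_Ident_left[OF that(1)] by simp
    ultimately show "\<exists>!h. h \<in> Hom C T A \<and> i1 \<cdot> h = u" using pu by blast
  qed (use e in simp)
qed

text \<open>The injections are jointly epic: composing a morphism with the decomposition of the
  identity recovers it from its two components.\<close>

lemma biproduct_Comp_cong:
  assumes "is_biproduct C A B P i1 i2 p1 p2" and h: "h \<in> Hom C P Q" "h' \<in> Hom C P Q"
    and eq: "h \<cdot> i1 = h' \<cdot> i1" "h \<cdot> i2 = h' \<cdot> i2"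
  shows "h = h'"
proof -
  have i1: "i1 \<in> Hom C A P" and i2: "i2 \<in> Hom C B P" and p1: "p1 \<in> Hom C P A" and p2: "p2 \<in> Hom C P B"
    and sum: "(i1 \<cdot> p1) \<boxplus> (i2 \<cdot> p2) = Ident C P"
    using assms by (auto simp: is_biproduct_def)
  have "g = (g \<cdot> i1) \<cdot> p1 \<boxplus> (g \<cdot> i2) \<cdot> p2" if "g \<in> Hom C P Q" for g
    using Comp_Plus_right[OF Comp_in_Hom[OF p1 i1] Comp_in_Hom[OF p2 i2] that] sum
      Comp_assoc[OF p1 i1 that] Comp_assoc[OF p2 i2 that] Comp_Ident_right[OF that] by simp
  then show ?thesis using h eq by metis
qed

text \<open>The morphism is \<open>i1' \<cdot> p1 \<boxplus> i2' \<cdot> p2\<close>. Applied in both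
  directions, it produces the mutually inverse morphisms needed for uniqueness of
  biproducts.\<close>

lemma biproduct_comparison:
  assumes b: "is_biproduct C A B P i1 i2 p1 p2" and b': "is_biproduct C A B P' i1' i2' p1' p2'"
  obtains h where "h \<in> Hom C P P'" "h \<cdot> i1 = i1'" "h \<cdot> i2 = i2'" "p2' \<cdot> h = p2"
proof -
  have ob: "A \<in> Obj C" "B \<in> Obj C"
    and i1: "i1 \<in> Hom C A P" and i2: "i2 \<in> Hom C B P" and p1: "p1 \<in> Hom C P A" and p2: "p2 \<in> Hom C P B"
    and e: "p1 \<cdot> i1 = Ident C A" "p2 \<cdot> i1 = Zero_arr C A B" "p1 \<cdot> i2 = Zero_arr C B A" "p2 \<cdot> i2 = Ident C B"
    using b by (auto simp: is_biproduct_def)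
  have i1': "i1' \<in> Hom C A P'" and i2': "i2' \<in> Hom C B P'" and p2': "p2' \<in> Hom C P' B"
    and e': "p2' \<cdot> i1' = Zero_arr C A B" "p2' \<cdot> i2' = Ident C B"
    using b' by (auto simp: is_biproduct_def)
  have l: "i1' \<cdot> p1 \<in> Hom C P P'" and r: "i2' \<cdot> p2 \<in> Hom C P P'"
    using Comp_in_Hom p1 i1' p2 i2' by blast+
  define h where "h = i1' \<cdot> p1 \<boxplus> i2' \<cdot> p2"
  have h: "h \<in> Hom C P P'" using Plus_in_Hom[OF l r] by (simp add: h_def)
  moreover have "h \<cdot> i1 = i1'"
    using Comp_Plus_left[OF i1 l r] Comp_assoc[OF i1 p1 i1'] Comp_assoc[OF i1 p2 i2'] e
      Comp_Ident_right[OF i1'] Comp_Zero[OF i2' ob(1)] Plus_Zero_right[OF i1'] by (simp add: h_def)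
  moreover have "h \<cdot> i2 = i2'"
    using Comp_Plus_left[OF i2 l r] Comp_assoc[OF i2 p1 i1'] Comp_assoc[OF i2 p2 i2'] e
      Comp_Ident_right[OF i2'] Comp_Zero[OF i1' ob(2)] Plus_Zero_left[OF i2'] by (simp add: h_def)
  moreover have "p2' \<cdot> h = p2"
    using Comp_Plus_right[OF l r p2'] Comp_assoc[OF p1 i1' p2'] Comp_assoc[OF p2 i2' p2'] e'
      Comp_Ident_left[OF p2] Zero_Comp[OF p1 ob(2)] Plus_Zero_left[OF p2] by (simp add: h_def)
  ultimately show ?thesis using that by blast
qed

lemma biproduct_unique:
  assumes b: "is_biproduct C A B P i1 i2 p1 p2" and b': "is_biproduct C A B P' i1' i2' p1' p2'"
  obtains h where "h \<in> Hom C P P'" "is_iso C h" "h \<cdot> i1 = i1'" "p2' \<cdot> h = p2"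
proof -
  obtain h where h: "h \<in> Hom C P P'" "h \<cdot> i1 = i1'" "h \<cdot> i2 = i2'" "p2' \<cdot> h = p2"
    using biproduct_comparison[OF b b'] .
  obtain g where g: "g \<in> Hom C P' P" "g \<cdot> i1' = i1" "g \<cdot> i2' = i2"
    using biproduct_comparison[OF b' b] .
  have i: "i1 \<in> Hom C A P" "i2 \<in> Hom C B P" "i1' \<in> Hom C A P'" "i2' \<in> Hom C B P'"
    and ob: "P \<in> Obj C" "P' \<in> Obj C"
    using b b' by (auto simp: is_biproduct_def)
  have "g \<cdot> h = Ident C P"
    by (rule biproduct_Comp_cong[OF b Comp_in_Hom[OF h(1) g(1)] Ident_in_Hom[OF ob(1)]])
      (use h g Comp_assoc[OF i(1) h(1) g(1)] Comp_assoc[OF i(2) h(1) g(1)]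
        Comp_Ident_left[OF i(1)] Comp_Ident_left[OF i(2)] in simp_all)
  moreover have "h \<cdot> g = Ident C P'"
    by (rule biproduct_Comp_cong[OF b' Comp_in_Hom[OF g(1) h(1)] Ident_in_Hom[OF ob(2)]])
      (use h g Comp_assoc[OF i(3) g(1) h(1)] Comp_assoc[OF i(4) g(1) h(1)]
        Comp_Ident_left[OF i(3)] Comp_Ident_left[OF i(4)] in simp_all)
  ultimately have "is_iso C h" using is_isoI h g by blast
  then show ?thesis using that h by blast
qed

end


section \<open>Conflations\<close>

context exact_category
begin

section \<open>Completing inflations and deflations to conflations\<close>

lemma conflation_Hom:
  assumes "(i, d) \<in> Conflations C"
  shows "i \<in> Hom C (Dom C i) (Cod C i)" "d \<in> Hom C (Cod C i) (Cod C d)"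
proof -
  have "is_kernel C i d" using conflation_kernel_cokernel[OF assms] by blast
  then have "i \<in> Arr C" "d \<in> Arr C" "Cod C i = Dom C d" unfolding is_kernel_def by blast+
  then show "i \<in> Hom C (Dom C i) (Cod C i)" "d \<in> Hom C (Cod C i) (Cod C d)"
    by (simp_all add: Hom_def)
qed

text \<open>A deflation comes with some conflation, and its inflation is a kernel isomorphic to
  \<open>k\<close>. Closure of conflations under isomorphism then transports the conflation to
  \<open>k\<close>.\<close>

lemma kernel_conflation:
  assumes "d \<in> Deflations C" "is_kernel C k d"
  shows "(k, d) \<in> Conflations C"
proof -
  obtain i where i: "(i, d) \<in> Conflations C" using assms by (auto simp: Deflations_def)
  have d: "d \<in> Hom C (Cod C i) (Cod C d)" and i': "i \<in> Hom C (Dom C i) (Cod C i)"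
    using conflation_Hom[OF i] by auto
  have k: "k \<in> Hom C (Dom C k) (Cod C i)"
    using assms(2) HomD[OF d] by (auto simp: is_kernel_def Hom_def)
  obtain a where a: "a \<in> Hom C (Dom C i) (Dom C k)" "is_iso C a" "k \<cdot> a = i"
    using kernel_unique[OF _ assms(2) i' k d] conflation_kernel_cokernel[OF i] by blast
  show ?thesis
  proof (rule conflation_iso_closed[OF i _ _ _ a(1)])
    show "k \<in> Arr C" "d \<in> Arr C" "Cod C k = Dom C d" using HomD[OF k] HomD[OF d] by auto
    show "Ident C (Cod C i) \<in> Hom C (Cod C i) (Cod C k)" "Ident C (Cod C d) \<in> Hom C (Cod C d) (Cod C d)"
      using HomD[OF k] HomD[OF d] Ident_in_Hom by auto
    show "is_iso C (Ident C (Cod C i))" "is_iso C (Ident C (Cod C d))"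
      using HomD[OF k] HomD[OF d] is_iso_Ident by auto
    show "Ident C (Cod C i) \<cdot> i = k \<cdot> a" using a Comp_Ident_left[OF i'] by simp
    show "Ident C (Cod C d) \<cdot> d = d \<cdot> Ident C (Cod C i)"
      using Comp_Ident_left[OF d] Comp_Ident_right[OF d] by simp
  qed (rule a)
qed

lemma cokernel_conflation:
  assumes "i \<in> Inflations C" "is_cokernel C c i"
  shows "(i, c) \<in> Conflations C"
proof -
  obtain d where d: "(i, d) \<in> Conflations C" using assms by (auto simp: Inflations_def)
  have d': "d \<in> Hom C (Cod C i) (Cod C d)" and i: "i \<in> Hom C (Dom C i) (Cod C i)"
    using conflation_Hom[OF d] by auto
  have c: "c \<in> Hom C (Cod C i) (Cod C c)"
    using assms(2) by (auto simp: is_cokernel_def Hom_def)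
  obtain a where a: "a \<in> Hom C (Cod C d) (Cod C c)" "is_iso C a" "a \<cdot> d = c"
    using cokernel_unique[OF _ assms(2) d' c i] conflation_kernel_cokernel[OF d] by blast
  show ?thesis
  proof (rule conflation_iso_closed[OF d _ _ _ _ _ a(1)])
    show "i \<in> Arr C" "c \<in> Arr C" "Cod C i = Dom C c" using HomD[OF c] HomD[OF i] by auto
    show "Ident C (Cod C i) \<in> Hom C (Cod C i) (Cod C i)" "Ident C (Dom C i) \<in> Hom C (Dom C i) (Dom C i)"
      using HomD[OF i] Ident_in_Hom by auto
    show "is_iso C (Ident C (Cod C i))" "is_iso C (Ident C (Dom C i))"
      using HomD[OF i] is_iso_Ident by auto
    show "Ident C (Cod C i) \<cdot> i = i \<cdot> Ident C (Dom C i)"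
      using Comp_Ident_left[OF i] Comp_Ident_right[OF i] by simp
    show "a \<cdot> d = c \<cdot> Ident C (Cod C i)"
      using a Comp_Ident_right[OF c] by simp
  qed (rule a)
qed

section \<open>Pushouts and pullbacks of conflations\<close>

text \<open>The pushout property applied to \<open>d\<close> and zero yields \<open>d'\<close>. A
  morphism that kills \<open>i'\<close> also kills \<open>i\<close> after composing with
  \<open>f'\<close>, so it factors through \<open>d\<close>; this factor is the required one through
  \<open>d'\<close>.\<close>

lemma pushout_conflation:
  assumes c: "(i, d) \<in> Conflations C" and po: "is_pushout C i f i' f'" and i': "i' \<in> Inflations C"
  obtains d' where "(i', d') \<in> Conflations C" "Cod C d' = Cod C d" "d' \<cdot> f' = d"
proof -
  define A E B L P where "A = Dom C i" and "E = Cod C i" and "B = Cod C d" and "L = Cod C f"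
    and "P = Cod C i'"
  have h: "i \<in> Hom C A E" "d \<in> Hom C E B" "f \<in> Hom C A L" "i' \<in> Hom C L P" "f' \<in> Hom C E P"
    using conflation_Hom[OF c] po
    by (auto simp: A_def E_def B_def L_def P_def is_pushout_def Hom_def)
  have ob: "A \<in> Obj C" "E \<in> Obj C" "B \<in> Obj C" "L \<in> Obj C" "P \<in> Obj C"
    using h HomD by blast+
  have comm: "f' \<cdot> i = i' \<cdot> f" using po by (simp add: is_pushout_def)
  have univ: "\<exists>!h. h \<in> Hom C P T \<and> h \<cdot> f' = u \<and> h \<cdot> i' = v"
    if "u \<in> Hom C E T" "v \<in> Hom C L T" "u \<cdot> i = v \<cdot> f" for T u v
    using po that HomD[OF that(1)] unfolding is_pushout_def E_def L_def P_def by blast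
  have coker: "is_cokernel C d i" using conflation_kernel_cokernel[OF c] by simp
  have di: "d \<cdot> i = Zero_arr C A B" using coker is_cokernel_iff[OF h(2,1)] by blast
  have Z: "Zero_arr C L B \<in> Hom C L B" using Zero_in_Hom ob by blast
  obtain d' where d': "d' \<in> Hom C P B" "d' \<cdot> f' = d" "d' \<cdot> i' = Zero_arr C L B"
    using univ[OF h(2) Z] di Zero_Comp[OF h(3) ob(3)] by auto
  have "is_cokernel C d' i'" unfolding is_cokernel_iff[OF d'(1) h(4)]
  proof (intro conjI ballI impI)
    fix T u assume T: "T \<in> Obj C" and u: "u \<in> Hom C P T" and z: "u \<cdot> i' = Zero_arr C L T"
    have uf: "u \<cdot> f' \<in> Hom C E T" using Comp_in_Hom u h by blast
    have ufi: "(u \<cdot> f') \<cdot> i = Zero_arr C A T"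
      using Comp_assoc[OF h(1) h(5) u] Comp_assoc[OF h(3) h(4) u] comm z Zero_Comp[OF h(3) T] by simp
    obtain g where g: "g \<in> Hom C B T" "g \<cdot> d = u \<cdot> f'"
      using cokernel_factor[OF coker h(2,1) uf ufi] .
    have "g \<cdot> d' = u"
    proof -
      \<comment> \<open>\<open>g \<cdot> d'\<close> and \<open>u\<close> agree after composition
        with \<open>f'\<close> and with \<open>i'\<close>, so the uniqueness half of the pushout
        property makes them equal.\<close>
      have ex1: "\<exists>!h. h \<in> Hom C P T \<and> h \<cdot> f' = u \<cdot> f' \<and> h \<cdot> i' = u \<cdot> i'"
        by (rule univ) (use uf u h z ufi Zero_in_Hom Zero_Comp ob T in auto)
      have "g \<cdot> d' \<in> Hom C P T" using g d' Comp_in_Hom by blast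
      moreover have "(g \<cdot> d') \<cdot> f' = u \<cdot> f'" using Comp_assoc[OF h(5) d'(1) g(1)] d' g by simp
      moreover have "(g \<cdot> d') \<cdot> i' = u \<cdot> i'"
        using Comp_assoc[OF h(4) d'(1) g(1)] d' z Comp_Zero[OF g(1)] ob by simp
      ultimately show ?thesis using ex1 u by blast
    qed
    moreover have "g' = g" if g': "g' \<in> Hom C B T" "g' \<cdot> d' = u" for g'
    proof (rule cokernel_epi[OF coker h(2) g'(1) g(1)])
      show "g' \<cdot> d = g \<cdot> d" using g g' Comp_assoc[OF h(5) d'(1) g'(1)] d' by simp
    qed
    ultimately show "\<exists>!h. h \<in> Hom C B T \<and> h \<cdot> d' = u" using g by blast
  qed (rule d')
  then show ?thesis
    using that cokernel_conflation[OF i'] d' HomD[OF d'(1)] by (auto simp: B_def)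
qed

text \<open>Dual to the pushout case: \<open>i'\<close> is induced by \<open>i\<close> and zero, and
  a morphism killed by \<open>d'\<close> factors through \<open>i\<close> after composing with
  \<open>f'\<close>.\<close>

lemma pullback_conflation:
  assumes c: "(i, d) \<in> Conflations C" and pb: "is_pullback C d f d' f'" and d': "d' \<in> Deflations C"
  obtains i' where "(i', d') \<in> Conflations C" "Dom C i' = Dom C i" "f' \<cdot> i' = i"
proof -
  define A E B L P where "A = Dom C i" and "E = Cod C i" and "B = Cod C d" and "L = Dom C f"
    and "P = Dom C d'"
  have h: "i \<in> Hom C A E" "d \<in> Hom C E B" "f \<in> Hom C L B" "d' \<in> Hom C P L" "f' \<in> Hom C P E"
    using conflation_Hom[OF c] pb
    by (auto simp: A_def E_def B_def L_def P_def is_pullback_def Hom_def)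
  have ob: "A \<in> Obj C" "E \<in> Obj C" "B \<in> Obj C" "L \<in> Obj C" "P \<in> Obj C"
    using h HomD by blast+
  have comm: "d \<cdot> f' = f \<cdot> d'" using pb by (simp add: is_pullback_def)
  have univ: "\<exists>!h. h \<in> Hom C T P \<and> f' \<cdot> h = u \<and> d' \<cdot> h = v"
    if "u \<in> Hom C T E" "v \<in> Hom C T L" "d \<cdot> u = f \<cdot> v" for T u v
  proof -
    have E: "E = Dom C d" using HomD[OF h(2)] by simp
    show ?thesis
      using pb that HomD[OF that(1)] unfolding is_pullback_def E L_def P_def by blast
  qed
  have ker: "is_kernel C i d" using conflation_kernel_cokernel[OF c] by simp
  have di: "d \<cdot> i = Zero_arr C A B" using ker is_kernel_iff[OF h(1,2)] by blast
  have Z: "Zero_arr C A L \<in> Hom C A L" using Zero_in_Hom ob by blast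
  obtain i' where i': "i' \<in> Hom C A P" "f' \<cdot> i' = i" "d' \<cdot> i' = Zero_arr C A L"
    using univ[OF h(1) Z] di Comp_Zero[OF h(3) ob(1)] by auto
  have "is_kernel C i' d'" unfolding is_kernel_iff[OF i'(1) h(4)]
  proof (intro conjI ballI impI)
    fix T u assume T: "T \<in> Obj C" and u: "u \<in> Hom C T P" and z: "d' \<cdot> u = Zero_arr C T L"
    have uf: "f' \<cdot> u \<in> Hom C T E" using Comp_in_Hom u h by blast
    have ufi: "d \<cdot> (f' \<cdot> u) = Zero_arr C T B"
      using Comp_assoc[OF u h(5) h(2)] Comp_assoc[OF u h(4) h(3)] comm z Comp_Zero[OF h(3) T] by simp
    obtain g where g: "g \<in> Hom C T A" "i \<cdot> g = f' \<cdot> u"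
      using kernel_factor[OF ker h(1,2) uf ufi] .
    have "i' \<cdot> g = u"
    proof -
      have ex1: "\<exists>!h. h \<in> Hom C T P \<and> f' \<cdot> h = f' \<cdot> u \<and> d' \<cdot> h = d' \<cdot> u"
        by (rule univ) (use uf u h z ufi Zero_in_Hom Comp_Zero ob T in auto)
      have "i' \<cdot> g \<in> Hom C T P" using g i' Comp_in_Hom by blast
      moreover have "f' \<cdot> (i' \<cdot> g) = f' \<cdot> u" using Comp_assoc[OF g(1) i'(1) h(5)] i' g by simp
      moreover have "d' \<cdot> (i' \<cdot> g) = d' \<cdot> u"
        using Comp_assoc[OF g(1) i'(1) h(4)] i' z Zero_Comp[OF g(1)] ob by simp
      ultimately show ?thesis using ex1 u by blast
    qed
    moreover have "g' = g" if g': "g' \<in> Hom C T A" "i' \<cdot> g' = u" for g'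
    proof (rule kernel_mono[OF ker h(1) g'(1) g(1)])
      show "i \<cdot> g' = i \<cdot> g" using g g' Comp_assoc[OF g'(1) i'(1) h(5)] i' by simp
    qed
    ultimately show "\<exists>!h. h \<in> Hom C T A \<and> i' \<cdot> h = u" using g by blast
  qed (rule i')
  then show ?thesis
    using that kernel_conflation[OF d'] i' HomD[OF i'(1)] by (auto simp: A_def)
qed


subsection \<open>Split conflations\<close>

text \<open>Only a section of the deflation is recorded. For conflations,
  \<open>splits_biproduct\<close> and \<open>retraction_splits\<close> show that this is equivalent
  to a retraction of the inflation.\<close>

definition splits :: "'m \<times> 'm \<Rightarrow> bool" where
  "splits = (\<lambda>(i, d). \<exists>s \<in> Hom C (Cod C d) (Cod C i). d \<cdot> s = Ident C (Cod C d))"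

text \<open>The complement of the idempotent \<open>s \<cdot> d\<close> is killed by
  \<open>d\<close>, hence equals \<open>i \<cdot> r\<close> for some \<open>r\<close>. This
  \<open>r\<close> is the missing projection; its identities are tested after composing with the
  monomorphism \<open>i\<close>.\<close>

lemma splits_biproduct:
  assumes c: "(i, d) \<in> Conflations C" and i: "i \<in> Hom C A E" and d: "d \<in> Hom C E B"
    and "splits (i, d)"
  obtains s r where "is_biproduct C A B E i s r d"
proof -
  have ker: "is_kernel C i d"
    using conflation_kernel_cokernel[OF c] by auto
  have ob: "A \<in> Obj C" "E \<in> Obj C" "B \<in> Obj C" using HomD i d by blast+
  have di: "d \<cdot> i = Zero_arr C A B" using ker is_kernel_iff[OF i d] by blast
  note ids = ob[THEN Ident_in_Hom]
  obtain s where s: "s \<in> Hom C B E" "d \<cdot> s = Ident C B"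
    using assms(4) HomD[OF i] HomD[OF d] by (auto simp: splits_def)
  have sd: "s \<cdot> d \<in> Hom C E E" using Comp_in_Hom[OF d s(1)] .
  obtain h where h: "h \<in> Hom C E E" "h \<boxplus> s \<cdot> d = Ident C E"
    using ex_difference[OF ids(2) sd] .
  have dsd: "d \<cdot> (s \<cdot> d) = d" using Comp_assoc[OF d s(1) d] s Comp_Ident_left[OF d] by simp
  have "d \<cdot> h \<boxplus> d = d"
    using Comp_Plus_right[OF h(1) sd d] h(2) Comp_Ident_right[OF d] dsd by simp
  then have "d \<cdot> h = Zero_arr C E B" using Plus_right_cancel[OF Comp_in_Hom[OF h(1) d] d] by simp
  then obtain r where r: "r \<in> Hom C E A" "i \<cdot> r = h" using kernel_factor[OF ker i d h(1)] by blast
  have ri: "r \<cdot> i = Ident C A"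
  proof (rule kernel_mono[OF ker i Comp_in_Hom[OF i r(1)] ids(1)])
    have "(s \<cdot> d) \<cdot> i = Zero_arr C A E"
      using Comp_assoc[OF i d s(1)] di Comp_Zero[OF s(1) ob(1)] by simp
    then have "h \<cdot> i = i"
      using Comp_Plus_left[OF i h(1) sd] h(2) Comp_Ident_left[OF i]
        Plus_Zero_right[OF Comp_in_Hom[OF i h(1)]] by simp
    then show "i \<cdot> (r \<cdot> i) = i \<cdot> Ident C A"
      using Comp_assoc[OF i r(1) i] r Comp_Ident_right[OF i] by simp
  qed
  have rs: "r \<cdot> s = Zero_arr C B A"
  proof (rule kernel_mono[OF ker i Comp_in_Hom[OF s(1) r(1)]])
    show "Zero_arr C B A \<in> Hom C B A" using Zero_in_Hom ob by blast
    have "(s \<cdot> d) \<cdot> s = s" using Comp_assoc[OF s(1) d s(1)] s Comp_Ident_right[OF s(1)] by simp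
    then have "h \<cdot> s \<boxplus> s = s"
      using Comp_Plus_left[OF s(1) h(1) sd] h(2) Comp_Ident_left[OF s(1)] by simp
    then have "h \<cdot> s = Zero_arr C B E" using Plus_right_cancel[OF Comp_in_Hom[OF s(1) h(1)] s(1)] by simp
    then show "i \<cdot> (r \<cdot> s) = i \<cdot> Zero_arr C B A"
      using Comp_assoc[OF s(1) r(1) i] r Comp_Zero[OF i ob(3)] by simp
  qed
  have "is_biproduct C A B E i s r d"
    unfolding is_biproduct_def using ob i s r d ri rs di h by simp
  then show ?thesis using that by blast
qed

text \<open>Dual construction: the complement of \<open>i \<cdot> r\<close> vanishes on
  \<open>i\<close>, hence factors through the cokernel \<open>d\<close> as
  \<open>s \<cdot> d\<close>, and \<open>s\<close> is the section.\<close>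

lemma retraction_splits:
  assumes c: "(i, d) \<in> Conflations C" and i: "i \<in> Hom C A E" and d: "d \<in> Hom C E B"
    and r: "r \<in> Hom C E A" "r \<cdot> i = Ident C A"
  shows "splits (i, d)"
proof -
  have ker: "is_kernel C i d" and coker: "is_cokernel C d i"
    using conflation_kernel_cokernel[OF c] by auto
  have ob: "A \<in> Obj C" "E \<in> Obj C" "B \<in> Obj C" using HomD i d by blast+
  have di: "d \<cdot> i = Zero_arr C A B" using ker is_kernel_iff[OF i d] by blast
  note ids = ob[THEN Ident_in_Hom]
  have ir: "i \<cdot> r \<in> Hom C E E" using Comp_in_Hom[OF r(1) i] .
  obtain h where h: "h \<in> Hom C E E" "h \<boxplus> i \<cdot> r = Ident C E"
    using ex_difference[OF ids(2) ir] .
  have iri: "(i \<cdot> r) \<cdot> i = i" using Comp_assoc[OF i r(1) i] r Comp_Ident_right[OF i] by simp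
  have "h \<cdot> i \<boxplus> i = i"
    using Comp_Plus_left[OF i h(1) ir] h(2) Comp_Ident_left[OF i] iri by simp
  then have "h \<cdot> i = Zero_arr C A E" using Plus_right_cancel[OF Comp_in_Hom[OF i h(1)] i] by simp
  then obtain s where s: "s \<in> Hom C B E" "s \<cdot> d = h" using cokernel_factor[OF coker d i h(1)] by blast
  have "d \<cdot> s = Ident C B"
  proof (rule cokernel_epi[OF coker d Comp_in_Hom[OF s(1) d] ids(3)])
    have "d \<cdot> (i \<cdot> r) = Zero_arr C E B"
      using Comp_assoc[OF r(1) i d] di Zero_Comp[OF r(1) ob(3)] by simp
    then have "d \<cdot> h = d"
      using Comp_Plus_right[OF h(1) ir d] h(2) Comp_Ident_right[OF d]
        Plus_Zero_right[OF Comp_in_Hom[OF h(1) d]] by simp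
    then show "(d \<cdot> s) \<cdot> d = Ident C B \<cdot> d"
      using Comp_assoc[OF d s(1) d] s Comp_Ident_left[OF d] by simp
  qed
  with s show ?thesis using HomD[OF i] HomD[OF d] by (auto simp: splits_def)
qed

section \<open>Vanishing of Ext as an extension and lifting property\<close>

text \<open>Vanishing of Ext expressed without equivalence classes; \<open>Ext1_eq_zero_iff\<close>
  connects it with \<open>Ext1\<close>.\<close>

definition ext_trivial :: "'o \<Rightarrow> 'o \<Rightarrow> bool" where
  "ext_trivial A B \<longleftrightarrow> (\<forall>e \<in> Extensions C A B. splits e)"

text \<open>The obstruction to extending \<open>f\<close> is the class in Ext of \<open>B\<close> by
  \<open>L\<close> of the conflation pushed out along \<open>f\<close>. When it splits, a retraction
  of \<open>i'\<close> composed with \<open>f'\<close> extends \<open>f\<close>.\<close>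

lemma extend_along_inflation:
  assumes c: "(i, d) \<in> Conflations C" and i: "i \<in> Hom C A E" and d: "d \<in> Hom C E B"
    and f: "f \<in> Hom C A L" and ext: "ext_trivial B L"
  obtains g where "g \<in> Hom C E L" "g \<cdot> i = f"
proof -
  have "i \<in> Inflations C" using c by (auto simp: Inflations_def)
  then obtain i' f' where po: "is_pushout C i f i' f'" and i': "i' \<in> Inflations C"
    using inflation_pushout[of i f] HomD[OF i] HomD[OF f] by auto
  obtain d' where d': "(i', d') \<in> Conflations C" "Cod C d' = Cod C d"
    using pushout_conflation[OF c po i'] by blast
  have h: "i' \<in> Hom C L (Cod C i')" "f' \<in> Hom C E (Cod C i')" "d' \<in> Hom C (Cod C i') B"
    and comm: "f' \<cdot> i = i' \<cdot> f"
    using po conflation_Hom[OF d'(1)] HomD[OF i] HomD[OF d] HomD[OF f] d'(2)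
    by (auto simp: is_pushout_def Hom_def)
  have "splits (i', d')"
    using ext d' HomD[OF h(1)] HomD[OF h(3)] by (auto simp: ext_trivial_def Extensions_def)
  then obtain r where r: "r \<in> Hom C (Cod C i') L" "r \<cdot> i' = Ident C L"
    using splits_biproduct[OF d'(1) h(1,3)] unfolding is_biproduct_def by metis
  have "(r \<cdot> f') \<cdot> i = f"
    using Comp_assoc[OF i h(2) r(1)] comm Comp_assoc[OF f h(1) r(1)] r(2) Comp_Ident_left[OF f] by simp
  then show ?thesis using that Comp_in_Hom[OF h(2) r(1)] by blast
qed

text \<open>Dually, the obstruction is the conflation pulled back along \<open>f\<close>; a section
  of \<open>d'\<close> followed by \<open>f'\<close> lifts \<open>f\<close>.\<close>

lemma lift_along_deflation:
  assumes c: "(i, d) \<in> Conflations C" and i: "i \<in> Hom C A E" and d: "d \<in> Hom C E B"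
    and f: "f \<in> Hom C L B" and ext: "ext_trivial L A"
  obtains g where "g \<in> Hom C L E" "d \<cdot> g = f"
proof -
  have "d \<in> Deflations C" using c by (auto simp: Deflations_def)
  then obtain d' f' where pb: "is_pullback C d f d' f'" and d': "d' \<in> Deflations C"
    using deflation_pullback[of d f] HomD[OF d] HomD[OF f] by auto
  obtain i' where i': "(i', d') \<in> Conflations C" "Dom C i' = Dom C i"
    using pullback_conflation[OF c pb d'] by blast
  have h: "d' \<in> Hom C (Dom C d') L" "f' \<in> Hom C (Dom C d') E"
    and comm: "d \<cdot> f' = f \<cdot> d'"
    using pb HomD[OF i] HomD[OF d] HomD[OF f]
    by (auto simp: is_pullback_def Hom_def)
  have "splits (i', d')"
    using ext i' HomD[OF h(1)] HomD[OF i] by (auto simp: ext_trivial_def Extensions_def)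
  then obtain s where s: "s \<in> Hom C L (Dom C d')" "d' \<cdot> s = Ident C L"
    using HomD[OF h(1)] HomD[OF conflation_Hom(2)[OF i'(1)]] by (auto simp: splits_def)
  have "d \<cdot> (f' \<cdot> s) = f"
    using Comp_assoc[OF s(1) h(2) d] comm Comp_assoc[OF s(1) h(1) f] s(2) Comp_Ident_right[OF f] by simp
  then show ?thesis using that Comp_in_Hom[OF s(1) h(2)] by blast
qed

lemma ext_trivial_zero_left:
  assumes "is_zero_object C Z"
  shows "ext_trivial Z B"
proof -
  have "splits (i, d)" if c: "(i, d) \<in> Conflations C" and "Cod C d = Z" for i d
  proof -
    have d: "d \<in> Hom C (Cod C i) Z" using conflation_Hom(2)[OF c] that by simp
    then have Z: "Z \<in> Obj C" using HomD by blast
    have s: "Zero_arr C Z (Cod C i) \<in> Hom C Z (Cod C i)"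
      using Zero_in_Hom HomD[OF d] by blast
    have "d \<cdot> Zero_arr C Z (Cod C i) = Ident C Z"
      using zero_object_Hom_eq[OF assms] Comp_in_Hom[OF s d] Ident_in_Hom[OF Z] by blast
    then show ?thesis using s that by (auto simp: splits_def)
  qed
  then show ?thesis by (auto simp: ext_trivial_def Extensions_def)
qed

lemma ext_trivial_zero_right:
  assumes "is_zero_object C Z"
  shows "ext_trivial A Z"
proof -
  have "splits (i, d)" if c: "(i, d) \<in> Conflations C" and "Dom C i = Z" for i d
  proof -
    have i: "i \<in> Hom C Z (Cod C i)" and d: "d \<in> Hom C (Cod C i) (Cod C d)"
      using conflation_Hom[OF c] that by auto
    have r: "Zero_arr C (Cod C i) Z \<in> Hom C (Cod C i) Z"
      using Zero_in_Hom HomD[OF i] by blast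
    have "Zero_arr C (Cod C i) Z \<cdot> i = Ident C Z"
      using zero_object_Hom_eq[OF assms] Comp_in_Hom[OF i r] Ident_in_Hom HomD[OF i] by blast
    then show ?thesis using retraction_splits[OF c i d r] by blast
  qed
  then show ?thesis by (auto simp: ext_trivial_def Extensions_def)
qed

text \<open>Given an extension with inflation \<open>i\<close> starting at \<open>B\<close>, extend
  \<open>a\<close> along \<open>i\<close> and follow with \<open>b\<close>: the composite is a
  retraction of \<open>i\<close>.\<close>

lemma ext_trivial_retract:
  assumes a: "a \<in> Hom C B L" and b: "b \<in> Hom C L B" and ba: "b \<cdot> a = Ident C B"
    and ext: "ext_trivial A L"
  shows "ext_trivial A B"
proof -
  have "splits (i, d)" if c: "(i, d) \<in> Conflations C" and "Dom C i = B" "Cod C d = A" for i d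
  proof -
    have i: "i \<in> Hom C B (Cod C i)" and d: "d \<in> Hom C (Cod C i) A"
      using conflation_Hom[OF c] that by auto
    obtain g where g: "g \<in> Hom C (Cod C i) L" "g \<cdot> i = a"
      using extend_along_inflation[OF c i d a ext] .
    have "(b \<cdot> g) \<cdot> i = Ident C B" using Comp_assoc[OF i g(1) b] g ba by simp
    then show ?thesis using retraction_splits[OF c i d Comp_in_Hom[OF g(1) b]] by blast
  qed
  then show ?thesis by (auto simp: ext_trivial_def Extensions_def)
qed

end

section \<open>Comparison with Yoneda Ext\<close>

context weakly_idempotent_complete_exact_category
begin

text \<open>The projection \<open>p2\<close> is a split epimorphism, hence a deflation by weak
  idempotent completeness, and \<open>i1\<close> is its kernel.\<close>

lemma biproduct_conflation:
  assumes "is_biproduct C A B P i1 i2 p1 p2"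
  shows "(i1, p2) \<in> Conflations C"
proof (rule kernel_conflation)
  have "p2 \<in> Hom C P B" "i2 \<in> Hom C B P" "p2 \<cdot> i2 = Ident C B"
    using assms by (simp_all add: is_biproduct_def)
  then have "split_epi C p2" by (auto simp: split_epi_def Hom_def)
  then show "p2 \<in> Deflations C" by (rule split_epi_deflation)
  show "is_kernel C i1 p2" using biproduct_kernel[OF assms] .
qed

lemma Ext1_eq_zero_iff:
  assumes "A \<in> Obj C" "B \<in> Obj C"
  shows "Ext1 C A B = {Ext1_zero C A B} \<longleftrightarrow> ext_trivial A B"
proof
  assume L: "Ext1 C A B = {Ext1_zero C A B}"
  have "splits (i, d)" if e: "(i, d) \<in> Extensions C A B" for i d
  proof -
    have "(i, d) \<in> Conflations C" "Cod C d = A" using e by (auto simp: Extensions_def)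
    with conflation_Hom have i: "i \<in> Hom C (Dom C i) (Cod C i)" and d: "d \<in> Hom C (Cod C i) A"
      by auto
    \<comment> \<open>Reflexivity puts the extension into its own class, which is the zero class by
      assumption. The extension is therefore equivalent to a biproduct, whose section is carried
      over by \<open>h\<close>.\<close>
    have "((i, d), (i, d)) \<in> ext_equiv C A B"
      using e Comp_Ident_left[OF i] Comp_Ident_right[OF d] HomD[OF i] Ident_in_Hom is_iso_Ident
      by (auto simp: ext_equiv_def)
    moreover have "ext_equiv C A B `` {(i, d)} = Ext1_zero C A B"
      using quotientI[OF e, of "ext_equiv C A B"] L unfolding Ext1_def by blast
    ultimately have "(i, d) \<in> Ext1_zero C A B" by auto
    then obtain P i1 i2 p1 p2 h where b: "is_biproduct C B A P i1 i2 p1 p2"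
      and h: "h \<in> Hom C (Cod C i1) (Cod C i)" "d \<cdot> h = p2"
      by (auto simp: Ext1_zero_def ext_equiv_def)
    have i2: "i2 \<in> Hom C A P" and e: "p2 \<cdot> i2 = Ident C A" and P: "Cod C i1 = P"
      using b by (auto simp: is_biproduct_def Hom_def)
    have h': "h \<in> Hom C P (Cod C i)" using h P by simp
    have "d \<cdot> (h \<cdot> i2) = Ident C A" using Comp_assoc[OF i2 h' d] h e by simp
    then show ?thesis using Comp_in_Hom[OF i2 h'] HomD[OF d] by (auto simp: splits_def)
  qed
  then show "ext_trivial A B" by (auto simp: ext_trivial_def)
next
  assume R: "ext_trivial A B"
  obtain P i1 i2 p1 p2 where b: "is_biproduct C B A P i1 i2 p1 p2"
    using ex_biproduct assms by blast
  have e: "(i1, p2) \<in> Extensions C A B"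
    using biproduct_conflation[OF b] b by (simp add: Extensions_def is_biproduct_def Hom_def)
  \<comment> \<open>All split extensions are biproducts, hence isomorphic to each other, so the
    relation is full. Since \<open>e\<close> makes \<open>Extensions C A B\<close> nonempty, it is
    the only class and coincides with \<open>Ext1_zero\<close>.\<close>
  have all: "ext_equiv C A B = Extensions C A B \<times> Extensions C A B"
  proof -
    have "((i, d), (i', d')) \<in> ext_equiv C A B"
      if e: "(i, d) \<in> Extensions C A B" "(i', d') \<in> Extensions C A B" for i d i' d'
    proof -
      have c: "(i, d) \<in> Conflations C" "(i', d') \<in> Conflations C"
        and i: "i \<in> Hom C B (Cod C i)" and d: "d \<in> Hom C (Cod C i) A"
        and i': "i' \<in> Hom C B (Cod C i')" and d': "d' \<in> Hom C (Cod C i') A"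
        using e conflation_Hom[of i d] conflation_Hom[of i' d'] by (auto simp: Extensions_def)
      have "splits (i, d)" "splits (i', d')" using R e by (auto simp: ext_trivial_def)
      then obtain s r s' r' where "is_biproduct C B A (Cod C i) i s r d"
        "is_biproduct C B A (Cod C i') i' s' r' d'"
        using splits_biproduct[OF c(1) i d] splits_biproduct[OF c(2) i' d'] by metis
      then obtain h where "h \<in> Hom C (Cod C i) (Cod C i')" "is_iso C h" "h \<cdot> i = i'" "d' \<cdot> h = d"
        using biproduct_unique by metis
      then show ?thesis using e by (auto simp: ext_equiv_def)
    qed
    then show ?thesis by (auto simp: ext_equiv_def)
  qed
  have "Ext1 C A B = {Extensions C A B}" using e by (auto simp: Ext1_def all quotient_def)
  moreover have "Ext1_zero C A B = Extensions C A B"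
  proof -
    have "(i1, p2) \<in> {(i1, p2). \<exists>P i2 p1. is_biproduct C B A P i1 i2 p1 p2}" using b by blast
    then show ?thesis unfolding Ext1_zero_def all using e by blast
  qed
  ultimately show "Ext1 C A B = {Ext1_zero C A B}" by simp
qed


section \<open>Hereditary cotorsion pairs\<close>

lemma cotorsion_pair_left_iff:
  assumes "cotorsion_pair C X Y"
  shows "A \<in> X \<longleftrightarrow> A \<in> Obj C \<and> (\<forall>F \<in> Y. ext_trivial A F)"
proof -
  have Y: "Y \<subseteq> Obj C" and X: "X = {A \<in> Obj C. \<forall>F \<in> Y. Ext1 C A F = {Ext1_zero C A F}}"
    using assms unfolding cotorsion_pair_def by - (elim conjE, assumption)+
  have "A \<in> X \<longleftrightarrow> A \<in> Obj C \<and> (\<forall>F \<in> Y. Ext1 C A F = {Ext1_zero C A F})"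
    by (subst X) simp
  moreover have "Ext1 C A F = {Ext1_zero C A F} \<longleftrightarrow> ext_trivial A F" if "A \<in> Obj C" "F \<in> Y" for F
    using Ext1_eq_zero_iff[OF that(1)] subsetD[OF Y that(2)] by simp
  ultimately show ?thesis by metis
qed

lemma cotorsion_pair_right_iff:
  assumes "cotorsion_pair C X Y"
  shows "B \<in> Y \<longleftrightarrow> B \<in> Obj C \<and> (\<forall>D \<in> X. ext_trivial D B)"
proof -
  have X: "X \<subseteq> Obj C" and Y: "Y = {B \<in> Obj C. \<forall>D \<in> X. Ext1 C D B = {Ext1_zero C D B}}"
    using assms unfolding cotorsion_pair_def by - (elim conjE, assumption)+
  have "B \<in> Y \<longleftrightarrow> B \<in> Obj C \<and> (\<forall>D \<in> X. Ext1 C D B = {Ext1_zero C D B})"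
    by (subst Y) simp
  moreover have "Ext1 C D B = {Ext1_zero C D B} \<longleftrightarrow> ext_trivial D B" if "B \<in> Obj C" "D \<in> X" for D
    using Ext1_eq_zero_iff[OF _ that(1)] subsetD[OF X that(2)] by simp
  ultimately show ?thesis by metis
qed

text \<open>Extensions of and by a zero object split. This provides the choice \<open>W = 0\<close>
  in the definition of weak equivalences.\<close>

lemma zero_object_in_cotorsion_pair:
  assumes "cotorsion_pair C X Y" "is_zero_object C Z"
  shows "Z \<in> X \<inter> Y"
proof -
  have "Z \<in> Obj C" using assms(2) by (simp add: is_zero_object_def)
  then show ?thesis
    using ext_trivial_zero_left[OF assms(2)] ext_trivial_zero_right[OF assms(2)]
      cotorsion_pair_left_iff[OF assms(1), of Z] cotorsion_pair_right_iff[OF assms(1), of Z] by blast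
qed

section \<open>Weak equivalences and the right class\<close>

text \<open>With \<open>W\<close> a zero object and \<open>t = 0\<close>, the domain of
  \<open>d\<close> is itself a biproduct with \<open>W\<close>, and the morphism
  \<open>(d, t)\<close> is just \<open>d\<close>.\<close>

lemma deflation_in_Weq_omega:
  assumes ct: "cotorsion_pair C X Y" and d: "d \<in> Deflations C" "is_kernel C k d" "Dom C k \<in> Y"
  shows "d \<in> Weq_omega C X Y"
proof -
  obtain Z where Z: "is_zero_object C Z" using ex_zero_object by blast
  have k: "k \<in> Hom C (Dom C k) (Dom C d)" and d': "d \<in> Hom C (Dom C d) (Cod C d)"
    using d(2) by (auto simp: is_kernel_def Hom_def)
  have ob: "Dom C d \<in> Obj C" "Cod C d \<in> Obj C" "Z \<in> Obj C"
    using HomD[OF d'] Z by (auto simp: is_zero_object_def)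
  define A where "A = Dom C d"
  let ?t = "Zero_arr C Z (Cod C d)"
  have zz: "Zero_arr C Z A \<in> Hom C Z A" "Zero_arr C A Z \<in> Hom C A Z" "?t \<in> Hom C Z (Cod C d)"
    "Ident C A \<in> Hom C A A" "Ident C Z \<in> Hom C Z Z" "Zero_arr C A (Cod C d) \<in> Hom C A (Cod C d)"
    using Zero_in_Hom Ident_in_Hom ob by (auto simp: A_def)
  have Z_Z: "Zero_arr C A Z \<cdot> Zero_arr C Z A = Ident C Z"
    by (rule zero_object_Hom_eq(1)[OF Z Comp_in_Hom[OF zz(1,2)] zz(5)])
  have A_A: "Zero_arr C Z A \<cdot> Zero_arr C A Z = Zero_arr C A A"
    using Zero_Comp[OF zz(2)] HomD[OF zz(1)] by simp
  have "is_biproduct C A Z A (Ident C A) (Zero_arr C Z A) (Ident C A) (Zero_arr C A Z)"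
    unfolding is_biproduct_def
    using zz HomD[OF zz(1)] Comp_Ident_left[OF zz(4)] Comp_Ident_left[OF zz(1)] Comp_Ident_right[OF zz(2)]
      Z_Z A_A Plus_Zero_right[OF zz(4)] by simp
  moreover have "d \<cdot> Ident C A \<boxplus> ?t \<cdot> Zero_arr C A Z = d"
    using Comp_Ident_right[OF d'] Zero_Comp[OF zz(2) ob(2)] Plus_Zero_right[OF d'] by (simp add: A_def)
  moreover have "d \<in> Arr C" using HomD[OF d'] by simp
  ultimately show ?thesis
    unfolding Weq_omega_def Let_def mem_Collect_eq A_def
    using zero_object_in_cotorsion_pair[OF ct Z] zz(3) d by metis
qed

text \<open>Every morphism into \<open>P\<close> factors through the kernel of \<open>(f, t)\<close>
  because the target is zero. Factoring \<open>i1\<close> and composing with \<open>p1\<close>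
  exhibits \<open>A\<close> as a retract of that kernel, and \<open>Y\<close> is closed under
  retracts.\<close>

lemma Weq_omega_to_zero_in_right_class:
  assumes ct: "cotorsion_pair C X Y" and Z: "is_zero_object C Z"
    and w: "f \<in> Weq_omega C X Y" and f: "f \<in> Hom C A Z"
  shows "A \<in> Y"
proof -
  obtain W t P i1 i2 p1 p2 k where t: "t \<in> Hom C W Z" and b: "is_biproduct C A W P i1 i2 p1 p2"
    and ker: "is_kernel C k (f \<cdot> p1 \<boxplus> t \<cdot> p2)" and K: "Dom C k \<in> Y"
    and defl: "f \<cdot> p1 \<boxplus> t \<cdot> p2 \<in> Deflations C"
    using w HomD[OF f] unfolding Weq_omega_def Let_def by auto
  define h where "h = f \<cdot> p1 \<boxplus> t \<cdot> p2"
  have i1: "i1 \<in> Hom C A P" and p1: "p1 \<in> Hom C P A" and p2: "p2 \<in> Hom C P W" and e: "p1 \<cdot> i1 = Ident C A"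
    using b by (auto simp: is_biproduct_def)
  have h: "h \<in> Hom C P Z"
    using Plus_in_Hom[OF Comp_in_Hom[OF p1 f] Comp_in_Hom[OF p2 t]] by (simp add: h_def)
  have k: "k \<in> Hom C (Dom C k) P"
    using ker HomD[OF h] by (auto simp: is_kernel_def Hom_def h_def)
  have "h \<cdot> i1 = Zero_arr C A Z"
    using zero_object_Hom_eq(1)[OF Z] Comp_in_Hom[OF i1 h] Zero_in_Hom HomD[OF f] by blast
  then obtain a where a: "a \<in> Hom C A (Dom C k)" "k \<cdot> a = i1"
    using kernel_factor[OF _ k h i1] ker by (auto simp: h_def)
  have pka: "(p1 \<cdot> k) \<cdot> a = Ident C A" using Comp_assoc[OF a(1) k p1] a e by simp
  show ?thesis
    using ext_trivial_retract[OF a(1) Comp_in_Hom[OF k p1] pka] K HomD[OF f]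
      cotorsion_pair_right_iff[OF ct, of A] cotorsion_pair_right_iff[OF ct, of "Dom C k"] by blast
qed

lemma right_class_closed_under_cokernels:
  assumes ct: "cotorsion_pair C X Y"
    and model: "model_structure C (CoFib_omega C X Y) (Fib_omega C X Y) (Weq_omega C X Y)"
    and i: "i \<in> Inflations C" "Dom C i \<in> Y" "Cod C i \<in> Y" and c: "is_cokernel C c i"
  shows "Cod C c \<in> Y"
proof -
  interpret M: model_structure C "CoFib_omega C X Y" "Fib_omega C X Y" "Weq_omega C X Y"
    by (rule model)
  obtain Z where Z: "is_zero_object C Z" using ex_zero_object by blast
  have conf: "(i, c) \<in> Conflations C" using cokernel_conflation[OF i(1) c] .
  define B where "B = Cod C i"
  have ch: "c \<in> Hom C B (Cod C c)" using conflation_Hom[OF conf] by (simp add: B_def)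
  have ob: "B \<in> Obj C" "Cod C c \<in> Obj C" "Z \<in> Obj C"
    using HomD[OF ch] Z by (auto simp: is_zero_object_def)
  let ?z = "Zero_arr C (Cod C c) Z" and ?b = "Zero_arr C B Z"
  have z: "?z \<in> Hom C (Cod C c) Z" and b: "?b \<in> Hom C B Z" using Zero_in_Hom ob by auto
  have zc: "?z \<cdot> c = ?b" using Zero_Comp[OF ch ob(3)] .
  have w1: "c \<in> Weq_omega C X Y"
    by (rule deflation_in_Weq_omega[OF ct, of _ i])
      (use conf conflation_kernel_cokernel[OF conf] i in \<open>auto simp: Deflations_def\<close>)
  \<comment> \<open>A morphism to a zero object is a split epimorphism, and its kernel is the
    identity of its domain; here the domain \<open>B\<close> lies in \<open>Y\<close>.\<close>
  have w2: "?b \<in> Weq_omega C X Y"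
  proof (rule deflation_in_Weq_omega[OF ct])
    have s: "Zero_arr C Z B \<in> Hom C Z B" using Zero_in_Hom ob by blast
    have "?b \<cdot> Zero_arr C Z B = Ident C Z"
      using zero_object_Hom_eq(1)[OF Z] Comp_in_Hom[OF s b] Ident_in_Hom[OF ob(3)] by blast
    then show "?b \<in> Deflations C"
      using s HomD[OF b] by (intro split_epi_deflation) (auto simp: split_epi_def)
    have I: "Ident C B \<in> Hom C B B" using Ident_in_Hom ob by blast
    show "is_kernel C (Ident C B) ?b"
      unfolding is_kernel_iff[OF I b] using Comp_Ident_right[OF b] Comp_Ident_left by auto
    show "Dom C (Ident C B) \<in> Y" using HomD[OF I] i by (simp add: B_def)
  qed
  \<comment> \<open>Two out of three for \<open>?z \<cdot> c = ?b\<close>, where \<open>c\<close>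
    and \<open>?b\<close> are already weak equivalences.\<close>
  have "?z \<in> Weq_omega C X Y"
    using M.two_out_of_three[of c ?z] w1 w2 zc HomD[OF ch] HomD[OF z] by auto
  then show ?thesis using Weq_omega_to_zero_in_right_class[OF ct Z _ z] by blast
qed

section \<open>The left class and kernels of deflations\<close>

text \<open>For a complete cotorsion pair one half of heredity implies the other:
  \<open>closed\<close> keeps the quotient \<open>G\<close> of an object of \<open>Y\<close> by a
  subobject in \<open>Y\<close> inside \<open>Y\<close>, which makes morphisms into \<open>G\<close>
  extendable.\<close>

lemma left_class_closed_under_kernels:
  assumes cct: "complete_cotorsion_pair C X Y"
    and closed: "\<And>i c. i \<in> Inflations C \<Longrightarrow> Dom C i \<in> Y \<Longrightarrow> Cod C i \<in> Y \<Longrightarrow> is_cokernel C c i \<Longrightarrow>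
      Cod C c \<in> Y"
    and defl: "d \<in> Deflations C" "Dom C d \<in> X" "Cod C d \<in> X" and ker: "is_kernel C k d"
  shows "Dom C k \<in> X"
proof -
  have ct: "cotorsion_pair C X Y" using cct by (simp add: complete_cotorsion_pair_def)
  note left = cotorsion_pair_left_iff[OF ct]
  have conf: "(k, d) \<in> Conflations C" using kernel_conflation[OF defl(1) ker] .
  define K X1 X2 where "K = Dom C k" and "X1 = Dom C d" and "X2 = Cod C d"
  have k: "k \<in> Hom C K X1" and d: "d \<in> Hom C X1 X2"
    using conflation_Hom[OF conf] HomD[OF conflation_Hom(2)[OF conf]] by (auto simp: K_def X1_def X2_def)
  have X: "X1 \<in> X" "X2 \<in> X" using defl by (auto simp: X1_def X2_def)
  have "splits (i, e)" if ext: "(i, e) \<in> Extensions C K B" and B: "B \<in> Y" for i e B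
  proof -
    define E where "E = Cod C i"
    have c: "(i, e) \<in> Conflations C" and i: "i \<in> Hom C B E" and e: "e \<in> Hom C E K"
      using ext conflation_Hom[of i e] by (auto simp: Extensions_def E_def)
    have iker: "is_kernel C i e" and ecok: "is_cokernel C e i"
      using conflation_kernel_cokernel[OF c] by auto
    have ei: "e \<cdot> i = Zero_arr C B K" using iker is_kernel_iff[OF i e] by blast
    have ob: "B \<in> Obj C" "E \<in> Obj C" "K \<in> Obj C" using HomD[OF i] HomD[OF e] by auto
    \<comment> \<open>Completeness embeds \<open>E\<close> into \<open>F\<close> in
      \<open>Y\<close>. With \<open>q\<close> the cokernel of \<open>j \<cdot> i\<close>, the object
      \<open>G\<close> is the quotient of \<open>F\<close> by \<open>B\<close>.\<close>
    obtain j p where c': "(j, p) \<in> Conflations C" and "Dom C j = E" and F': "Cod C j \<in> Y"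
      using cct ob unfolding complete_cotorsion_pair_def by blast
    define F D where "F = Cod C j" and "D = Cod C p"
    have j: "j \<in> Hom C E F" and p: "p \<in> Hom C F D"
      using conflation_Hom[OF c'] \<open>Dom C j = E\<close> by (auto simp: F_def D_def)
    have jker: "is_kernel C j p" using conflation_kernel_cokernel[OF c'] by auto
    have pj: "p \<cdot> j = Zero_arr C E D" using jker is_kernel_iff[OF j p] by blast
    have ji: "j \<cdot> i \<in> Hom C B F" using Comp_in_Hom[OF i j] .
    have ji_infl: "j \<cdot> i \<in> Inflations C"
      using inflation_Comp[of i j] c c' HomD[OF i] HomD[OF j] by (auto simp: Inflations_def)
    then obtain q where c'': "(j \<cdot> i, q) \<in> Conflations C" by (auto simp: Inflations_def)
    define G where "G = Cod C q"
    have q: "q \<in> Hom C F G" using conflation_Hom[OF c''] HomD[OF ji] by (auto simp: G_def)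
    have qker: "is_kernel C (j \<cdot> i) q" and qcok: "is_cokernel C q (j \<cdot> i)"
      using conflation_kernel_cokernel[OF c''] by auto
    have qji: "q \<cdot> (j \<cdot> i) = Zero_arr C B G" using qker is_kernel_iff[OF ji q] by blast
    have G: "G \<in> Y" using closed[OF ji_infl _ _ qcok] HomD[OF ji] B F' by (auto simp: G_def F_def)

    have qj: "q \<cdot> j \<in> Hom C E G" using Comp_in_Hom[OF j q] .
    \<comment> \<open>The induced morphism from \<open>K\<close>, the quotient of \<open>E\<close>
      by \<open>B\<close>, to \<open>G\<close>.\<close>
    obtain z where z: "z \<in> Hom C K G" "z \<cdot> e = q \<cdot> j"
      using cokernel_factor[OF ecok e i qj] Comp_assoc[OF i j q] qji by auto

    \<comment> \<open>A diagram chase without elements: pulling \<open>e\<close> back along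
      \<open>u\<close> replaces \<open>u\<close> by a morphism \<open>u'\<close> into
      \<open>E\<close>. As \<open>q\<close> kills \<open>j \<cdot> u'\<close>, it comes from
      \<open>B\<close>, hence so does \<open>u'\<close> because \<open>j\<close> is monic. Thus
      \<open>u \<cdot> e'\<close> is zero, and the deflation \<open>e'\<close> is epic.\<close>
    have z_mono: "u = Zero_arr C T K" if u: "u \<in> Hom C T K" and zu: "z \<cdot> u = Zero_arr C T G" for T u
    proof -
      have "e \<in> Deflations C" using c by (auto simp: Deflations_def)
      then obtain e' u' where pb: "is_pullback C e u e' u'" and e'd: "e' \<in> Deflations C"
        using deflation_pullback[of e u] HomD[OF e] HomD[OF u] by auto
      define S where "S = Dom C e'"
      have e': "e' \<in> Hom C S T" and u': "u' \<in> Hom C S E" and comm: "e \<cdot> u' = u \<cdot> e'"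
        using pb HomD[OF e] HomD[OF u] by (auto simp: is_pullback_def Hom_def S_def)
      have T: "S \<in> Obj C" "T \<in> Obj C" "G \<in> Obj C" using HomD[OF e'] HomD[OF q] by auto
      have "q \<cdot> (j \<cdot> u') = (z \<cdot> e) \<cdot> u'" using Comp_assoc[OF u' j q] z by simp
      also have "\<dots> = z \<cdot> (u \<cdot> e')" using Comp_assoc[OF u' e z(1)] comm by simp
      also have "\<dots> = Zero_arr C S G" using Comp_assoc[OF e' u z(1)] zu Zero_Comp[OF e' T(3)] by simp
      finally obtain v where v: "v \<in> Hom C S B" "(j \<cdot> i) \<cdot> v = j \<cdot> u'"
        using kernel_factor[OF qker ji q Comp_in_Hom[OF u' j]] by blast
      have "i \<cdot> v = u'"
        using kernel_mono[OF jker j Comp_in_Hom[OF v(1) i] u'] Comp_assoc[OF v(1) i j] v by simp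
      then have "u \<cdot> e' = Zero_arr C S K"
        using comm Comp_assoc[OF v(1) i e] ei Zero_Comp[OF v(1) ob(3)] by simp
      then have eq: "u \<cdot> e' = Zero_arr C T K \<cdot> e'" using Zero_Comp[OF e' ob(3)] by simp
      obtain l where "(l, e') \<in> Conflations C" using e'd by (auto simp: Deflations_def)
      then show ?thesis
        using cokernel_epi[OF _ e' u Zero_in_Hom[OF T(2) ob(3)] eq] conflation_kernel_cokernel by blast
    qed

    \<comment> \<open>\<open>G\<close> in \<open>Y\<close> removes the obstruction to extending
      \<open>z\<close> along \<open>k\<close>; \<open>B\<close> in \<open>Y\<close> then removes the
      obstruction to lifting this extension along \<open>q\<close>.\<close>
    have "ext_trivial X2 G" using left X G by blast
    then obtain y where y: "y \<in> Hom C X1 G" "y \<cdot> k = z"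
      using extend_along_inflation[OF conf k d z(1)] by blast
    have "ext_trivial X1 B" using left X B by blast
    then obtain x where x: "x \<in> Hom C X1 F" "q \<cdot> x = y"
      using lift_along_deflation[OF c'' ji q y(1)] by blast
    define s where "s = x \<cdot> k"
    have s: "s \<in> Hom C K F" using Comp_in_Hom[OF k x(1)] by (simp add: s_def)
    have qs: "q \<cdot> s = z" using Comp_assoc[OF k x(1) q] x y by (simp add: s_def)

    \<comment> \<open>To bring \<open>s\<close> back into \<open>E\<close>, the kernel of
      \<open>p\<close>, write \<open>p = p' \<cdot> q\<close>. Then \<open>p \<cdot> s\<close>
      equals \<open>p' \<cdot> z\<close>, which vanishes because it does so after composition with
      the epimorphism \<open>e\<close>.\<close>
    have "p \<cdot> (j \<cdot> i) = Zero_arr C B D"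
      using Comp_assoc[OF i j p] pj Zero_Comp[OF i] HomD[OF p] by simp
    then obtain p' where p': "p' \<in> Hom C G D" "p' \<cdot> q = p"
      using cokernel_factor[OF qcok q ji p] by blast
    have "p' \<cdot> z = Zero_arr C K D"
    proof (rule cokernel_epi[OF ecok e])
      show "p' \<cdot> z \<in> Hom C K D" using Comp_in_Hom[OF z(1) p'(1)] .
      show "Zero_arr C K D \<in> Hom C K D" using Zero_in_Hom ob HomD[OF p] by blast
      have "(p' \<cdot> z) \<cdot> e = p' \<cdot> (q \<cdot> j)" using Comp_assoc[OF e z(1) p'(1)] z by simp
      also have "\<dots> = p \<cdot> j" using Comp_assoc[OF j q p'(1)] p' by simp
      finally show "(p' \<cdot> z) \<cdot> e = Zero_arr C K D \<cdot> e"
        using pj Zero_Comp[OF e] HomD[OF p] by simp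
    qed
    then have "p \<cdot> s = Zero_arr C K D" using Comp_assoc[OF s q p'(1)] p' qs by simp
    then obtain \<sigma> where \<sigma>: "\<sigma> \<in> Hom C K E" "j \<cdot> \<sigma> = s"
      using kernel_factor[OF jker j p s] by blast
    have e\<sigma>: "e \<cdot> \<sigma> \<in> Hom C K K" using Comp_in_Hom[OF \<sigma>(1) e] .
    \<comment> \<open>Since \<open>z\<close> is monic, this makes \<open>\<sigma>\<close> a section
      of \<open>e\<close>. As \<open>z_mono\<close> speaks only of zero morphisms, it is applied to
      the difference \<open>h\<close> of the identity and \<open>e \<cdot> \<sigma>\<close>.\<close>
    have ze\<sigma>: "z \<cdot> (e \<cdot> \<sigma>) = z"
      using Comp_assoc[OF \<sigma>(1) e z(1)] z Comp_assoc[OF \<sigma>(1) j q] \<sigma> qs by simp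
    obtain h where h: "h \<in> Hom C K K" "h \<boxplus> e \<cdot> \<sigma> = Ident C K"
      using ex_difference[OF Ident_in_Hom[OF ob(3)] e\<sigma>] .
    have "z \<cdot> h \<boxplus> z = z"
      using Comp_Plus_right[OF h(1) e\<sigma> z(1)] h ze\<sigma> Comp_Ident_right[OF z(1)] by simp
    then have "h = Zero_arr C K K"
      using z_mono[OF h(1)] Plus_right_cancel[OF Comp_in_Hom[OF h(1) z(1)] z(1)] by simp
    then have "e \<cdot> \<sigma> = Ident C K" using h Plus_Zero_left[OF e\<sigma>] by simp
    then show ?thesis using \<sigma> HomD[OF e] by (auto simp: splits_def E_def)
  qed
  then have "ext_trivial K B" if "B \<in> Y" for B using that unfolding ext_trivial_def by auto
  then have "K \<in> X" using HomD[OF k] left[of K] by blast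
  then show ?thesis by (simp add: K_def)
qed

end

theorem proposition1p2:
  fixes \<A> :: "('o, 'm) exact_category" and \<X> \<Y> :: "'o set"
  assumes "weakly_idempotent_complete_exact_category \<A>"
    and "complete_cotorsion_pair \<A> \<X> \<Y>"
    and "model_structure \<A> (CoFib_omega \<A> \<X> \<Y>) (Fib_omega \<A> \<X> \<Y>) (Weq_omega \<A> \<X> \<Y>)"
  shows "hereditary_cotorsion_pair \<A> \<X> \<Y>"
proof -
  interpret weakly_idempotent_complete_exact_category \<A> by (rule assms(1))
  have ct: "cotorsion_pair \<A> \<X> \<Y>" using assms(2) by (simp add: complete_cotorsion_pair_def)
  note right = right_class_closed_under_cokernels[OF ct assms(3)]
  have left: "Dom \<A> k \<in> \<X>"
    if "d \<in> Deflations \<A>" "Dom \<A> d \<in> \<X>" "Cod \<A> d \<in> \<X>" "is_kernel \<A> k d" for d k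
    by (rule left_class_closed_under_kernels[OF assms(2) _ that]) (rule right)
  show ?thesis
    unfolding hereditary_cotorsion_pair_def
    by (intro conjI allI impI ct; elim conjE) (rule left right; assumption)+
qed

end
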